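(* Let $p$ be an odd prime and $n\ge2$. Let $A_1=p^{n-1}+\dots+p$ and $h_1=y_1$. Then $$B_{D_n}\big(\mathbb F_p(1,n-1)\big)=\{h_1^{(p-1)m}\ |\ 0\le m\le A_1\}$$ is a free module basis of $\mathbb F_p(1,n-1)=\mathbb F_p[y_1,\dots,y_n]^{P(1,n-1)}$ over $D_n=\mathbb F_p[y_1,\dots,y_n]^{GL(n,\mathbb F_p)}$.
   Context: $GL(n,\mathbb F_p)$ acts on $\mathbb F_p[y_1,\dots,y_n]$ by algebra automorphisms determined by $(a_{ij})\,y_k=\sum_i a_{ik}y_i$. The parabolic subgroup is $P(k,n-k)=\left\{\begin{pmatrix}A&C\\0&B\end{pmatrix}: A\in GL(k,\mathbb F_p),\ B\in GL(n-k,\mathbb F_p)\right\}$. For an algebra $A'$ over $A$, $B_A(A')$ denotes a free module basis of $A'$ over $A$. *)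

theory Defs
  imports
    "HOL-Library.Poly_Mapping"
    "Jordan_Normal_Form.Matrix"
    "Berlekamp_Zassenhaus.Finite_Field"
begin

text \<open>
  Conventions. The field with \<open>p\<close> elements is \<open>'p mod_ring\<close> for a type \<open>'p\<close> of prime cardinality \<open>p\<close>.
  Indices start at 0, as for the matrices: \<open>Var i\<close> stands for \<open>y\<^sub>i\<^sub>+\<^sub>1\<close>.
  A polynomial maps exponent vectors (of finite support) to coefficients; the type has the
  countably many variables \<open>Var 0, Var 1, \<dots>\<close>, and \<open>poly_ring n\<close> is the subring in the first \<open>n\<close>.
\<close>

type_synonym 'a mpoly = "(nat \<Rightarrow>\<^sub>0 nat) \<Rightarrow>\<^sub>0 'a"

definition Const :: "'a \<Rightarrow> 'a::comm_ring_1 mpoly"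
  where "Const c = Poly_Mapping.single 0 c"

definition Var :: "nat \<Rightarrow> 'a::comm_ring_1 mpoly"
  where "Var i = Poly_Mapping.single (Poly_Mapping.single i 1) 1"

definition poly_ring :: "nat \<Rightarrow> 'a::comm_ring_1 mpoly set"
  where "poly_ring n = {f. \<forall>m \<in> Poly_Mapping.keys f. Poly_Mapping.keys m \<subseteq> {..<n}}"

definition eval_monom :: "(nat \<Rightarrow> 'a::comm_ring_1 mpoly) \<Rightarrow> (nat \<Rightarrow>\<^sub>0 nat) \<Rightarrow> 'a mpoly"
  where "eval_monom s m = (\<Prod>k \<in> Poly_Mapping.keys m. s k ^ Poly_Mapping.lookup m k)"

definition subst_poly :: "(nat \<Rightarrow> 'a::comm_ring_1 mpoly) \<Rightarrow> 'a mpoly \<Rightarrow> 'a mpoly"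
  where "subst_poly s f =
    (\<Sum>m \<in> Poly_Mapping.keys f. Const (Poly_Mapping.lookup f m) * eval_monom s m)"

text \<open>
  The matrix \<open>g = (a\<^sub>i\<^sub>j)\<close> sends the \<open>k\<close>-th variable to the linear form given by its \<open>k\<close>-th column.
  On \<open>poly_ring n\<close>, for \<open>g\<close> of size \<open>n\<close>, only the columns \<open>k < n\<close> matter.
\<close>

definition act :: "'a::comm_ring_1 mat \<Rightarrow> 'a mpoly \<Rightarrow> 'a mpoly"
  where "act g = subst_poly (\<lambda>k. \<Sum>i<dim_row g. Const (g $$ (i, k)) * Var i)"

definition GL :: "nat \<Rightarrow> 'a::comm_ring_1 mat set"
  where "GL n = {g \<in> carrier_mat n n. invertible_mat g}"

definition parabolic :: "nat \<Rightarrow> nat \<Rightarrow> 'a::comm_ring_1 mat set"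
  where "parabolic k l =
    {four_block_mat A C (0\<^sub>m l k) B | A B C. A \<in> GL k \<and> B \<in> GL l \<and> C \<in> carrier_mat k l}"

definition invariants :: "nat \<Rightarrow> 'a::comm_ring_1 mat set \<Rightarrow> 'a mpoly set"
  where "invariants n G = {f \<in> poly_ring n. \<forall>g \<in> G. act g f = f}"

definition Dickson :: "nat \<Rightarrow> 'a::comm_ring_1 mpoly set"
  where "Dickson n = invariants n (GL n)"

definition parabolic_invariants :: "nat \<Rightarrow> nat \<Rightarrow> 'a::comm_ring_1 mpoly set"
  where "parabolic_invariants k l = invariants (k + l) (parabolic k l)"

text \<open>
  \<open>B\<close> is a basis of \<open>M\<close> as a module over \<open>R\<close>, where \<open>R\<close> and \<open>M\<close> are subsets of one commutative ring
  whose multiplication restricts to the scalar multiplication: \<open>M\<close> is exactly the set of finite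
  \<open>R\<close>-linear combinations of \<open>B\<close>, and \<open>B\<close> is linearly independent over \<open>R\<close>.
\<close>

definition free_module_basis :: "'r::comm_ring_1 set \<Rightarrow> 'r set \<Rightarrow> 'r set \<Rightarrow> bool"
  where "free_module_basis R M B \<longleftrightarrow>
    B \<subseteq> M \<and>
    M = {\<Sum>b\<in>S. c b * b | S c. finite S \<and> S \<subseteq> B \<and> (\<forall>b\<in>S. c b \<in> R)} \<and>
    (\<forall>S c. finite S \<and> S \<subseteq> B \<and> (\<forall>b\<in>S. c b \<in> R) \<and> (\<Sum>b\<in>S. c b * b) = 0 \<longrightarrow> (\<forall>b\<in>S. c b = 0))"

text \<open>
  Substitution is the algebra endomorphism determined by the images of the variables.
\<close>

lemma Const_add: "Const (a + b) = Const a + Const b"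
  by (simp add: Const_def single_add)

lemma Const_mult: "Const (a * b) = Const a * Const b"
  by (simp add: Const_def mult_single)

lemma Const_0 [simp]: "Const 0 = 0"
  by (simp add: Const_def)

lemma Const_1 [simp]: "Const 1 = 1"
  by (simp add: Const_def)

lemma eval_monom_superset:
  assumes "finite K" "Poly_Mapping.keys m \<subseteq> K"
  shows "eval_monom s m = (\<Prod>k\<in>K. s k ^ Poly_Mapping.lookup m k)"
  unfolding eval_monom_def
  by (rule prod.mono_neutral_left) (use assms in \<open>auto simp: in_keys_iff\<close>)

lemma eval_monom_add: "eval_monom s (m + m') = eval_monom s m * eval_monom s m'"
proof -
  let ?K = "Poly_Mapping.keys m \<union> Poly_Mapping.keys m'"
  have "eval_monom s (m + m') = (\<Prod>k\<in>?K. s k ^ Poly_Mapping.lookup (m + m') k)"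
    by (rule eval_monom_superset) (auto dest: subsetD[OF Poly_Mapping.keys_add])
  moreover have "eval_monom s m = (\<Prod>k\<in>?K. s k ^ Poly_Mapping.lookup m k)"
    by (rule eval_monom_superset) auto
  moreover have "eval_monom s m' = (\<Prod>k\<in>?K. s k ^ Poly_Mapping.lookup m' k)"
    by (rule eval_monom_superset) auto
  ultimately show ?thesis
    by (simp add: lookup_add power_add prod.distrib)
qed

lemma subst_poly_superset:
  assumes "finite K" "Poly_Mapping.keys f \<subseteq> K"
  shows "subst_poly s f = (\<Sum>m\<in>K. Const (Poly_Mapping.lookup f m) * eval_monom s m)"
  unfolding subst_poly_def
  by (rule sum.mono_neutral_left) (use assms in \<open>auto simp: in_keys_iff\<close>)

lemma subst_poly_single: "subst_poly s (Poly_Mapping.single m c) = Const c * eval_monom s m"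
  by (subst subst_poly_superset[of "{m}"]) auto

lemma subst_poly_add: "subst_poly s (f + g) = subst_poly s f + subst_poly s g"
proof -
  let ?K = "Poly_Mapping.keys f \<union> Poly_Mapping.keys g"
  have "subst_poly s (f + g) = (\<Sum>m\<in>?K. Const (Poly_Mapping.lookup (f + g) m) * eval_monom s m)"
    by (rule subst_poly_superset) (auto dest: subsetD[OF Poly_Mapping.keys_add])
  moreover have "subst_poly s f = (\<Sum>m\<in>?K. Const (Poly_Mapping.lookup f m) * eval_monom s m)"
    by (rule subst_poly_superset) auto
  moreover have "subst_poly s g = (\<Sum>m\<in>?K. Const (Poly_Mapping.lookup g m) * eval_monom s m)"
    by (rule subst_poly_superset) auto
  ultimately show ?thesis
    by (simp add: lookup_add Const_add ring_distribs sum.distrib)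
qed

lemma subst_poly_0 [simp]: "subst_poly s 0 = 0"
  by (simp add: subst_poly_def)

lemma subst_poly_sum: "subst_poly s (\<Sum>i\<in>I. f i) = (\<Sum>i\<in>I. subst_poly s (f i))"
  by (induction I rule: infinite_finite_induct) (auto simp: subst_poly_add)

lemma mpoly_sum_single:
  "f = (\<Sum>m\<in>Poly_Mapping.keys f. Poly_Mapping.single m (Poly_Mapping.lookup f m))"
  by (rule poly_mapping_eqI) (auto simp: lookup_sum lookup_single when_def in_keys_iff)

lemma subst_poly_mult: "subst_poly s (f * g) = subst_poly s f * subst_poly s g"
proof -
  have "f * g = (\<Sum>m\<in>Poly_Mapping.keys f. \<Sum>m'\<in>Poly_Mapping.keys g.
      Poly_Mapping.single (m + m') (Poly_Mapping.lookup f m * Poly_Mapping.lookup g m'))"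
    by (subst (1) mpoly_sum_single[of f], subst (1) mpoly_sum_single[of g])
      (simp add: sum_product mult_single)
  then have "subst_poly s (f * g) = (\<Sum>m\<in>Poly_Mapping.keys f. \<Sum>m'\<in>Poly_Mapping.keys g.
      (Const (Poly_Mapping.lookup f m) * eval_monom s m) *
      (Const (Poly_Mapping.lookup g m') * eval_monom s m'))"
    by (simp add: subst_poly_sum subst_poly_single eval_monom_add Const_mult mult_ac)
  also have "\<dots> = subst_poly s f * subst_poly s g"
    by (simp add: subst_poly_def sum_product)
  finally show ?thesis .
qed

lemma subst_poly_Const [simp]: "subst_poly s (Const c) = Const c"
  by (simp add: Const_def[of c] subst_poly_single eval_monom_def)

lemma subst_poly_Var [simp]: "subst_poly s (Var i) = s i"
  by (simp add: Var_def subst_poly_single eval_monom_def)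

lemma act_Var: "act g (Var k) = (\<Sum>i<dim_row g. Const (g $$ (i, k)) * Var i)"
  by (simp add: act_def)

end

theory Submission
  imports Defs "Jordan_Normal_Form.Determinant"
begin

text \<open>
  Write \<open>q\<close> for the size of the field, \<open>V\<close> for the set of the \<open>q\<^sup>n - 1\<close> nonzero linear forms and
  \<open>L\<close> for their product.

  Independence: \<open>GL\<close> acts transitively on \<open>V\<close>, so a relation
  \<open>\<Sum>m\<le>A. c m * y ^ ((q - 1) * m) = 0\<close> over the Dickson algebra for \<open>y = y\<^sub>1\<close> holds for every \<open>y \<in> V\<close>.
  It is a polynomial equation in \<open>y\<close> of degree at most \<open>q\<^sup>n - q\<close> with more roots than that.

  Spanning: an invariant \<open>f\<close> of the parabolic subgroup has one translate \<open>f\<^sub>v\<close> for each \<open>v \<in> V\<close>. Since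
  \<open>v * (\<Prod>u\<in>V - {v}. v - u) = L\<close>, the polynomial
  \<open>F(X) = (\<Sum>v\<in>V. f\<^sub>v * v * (\<Prod>u\<in>V - {v}. X - u))\<close> takes the values \<open>f\<^sub>v * L\<close> on \<open>V\<close>. Interpolation of degree
  less than \<open>q\<^sup>n - 1\<close> is unique, so the coefficients of \<open>F\<close> are invariant under \<open>GL\<close> and only exponents
  divisible by \<open>q - 1\<close> occur. Modulo \<open>y\<^sub>1\<close> the summands coincide in groups of \<open>q\<close>, so \<open>y\<^sub>1\<close> divides the
  coefficients; by invariance so do \<open>y\<^sub>1 ^ (q - 1)\<close>, then every \<open>v ^ (q - 1)\<close>, and finally \<open>L\<close>.
  Evaluating \<open>F\<close> at \<open>y\<^sub>1\<close> and dividing by \<open>L\<close> expands \<open>f\<close>.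
\<close>

section \<open>Substitution in polynomials\<close>

lemma Const_eq_iff [simp]: "Const a = Const b \<longleftrightarrow> a = b"
  by (metis Const_def lookup_single_eq)

lemma Const_eq_0_iff [simp]: "Const c = 0 \<longleftrightarrow> c = 0"
  and Const_eq_1_iff [simp]: "Const c = 1 \<longleftrightarrow> c = 1"
  using Const_eq_iff[of c 0] Const_eq_iff[of c 1] by auto

lemma Const_uminus: "Const (- a) = - Const a"
  by (metis Const_0 Const_add add.right_inverse add_eq_0_iff)

lemma Const_sum: "Const (\<Sum>i\<in>I. a i) = (\<Sum>i\<in>I. Const (a i))"
  by (induction I rule: infinite_finite_induct) (auto simp: Const_add)

lemma Const_power: "Const (a ^ k) = Const a ^ k"
  by (induction k) (auto simp: Const_mult)

lemma Const_of_nat: "Const (of_nat k) = of_nat k"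
  by (induction k) (auto simp: Const_add)

lemma Var_power: "Var i ^ k = Poly_Mapping.single (Poly_Mapping.single i k) 1"
  by (induction k) (auto simp: Var_def mult_single simp flip: single_add)

lemma eval_monom_Var: "eval_monom Var m = Poly_Mapping.single m 1"
proof -
  have *: "(\<Prod>k\<in>K. Var k ^ e k) = Poly_Mapping.single (\<Sum>k\<in>K. Poly_Mapping.single k (e k)) 1"
    for K :: "nat set" and e
    by (induction K rule: infinite_finite_induct) (auto simp: Var_power mult_single)
  show ?thesis
    unfolding eval_monom_def * by (simp flip: mpoly_sum_single)
qed

text \<open>Polynomials are generated by constants and variables. Only variables occurring in
  \<open>f\<close> enter the \<open>Var\<close> case, which is what lets the rule specialise to
  \<open>poly_ring n\<close>.\<close>

lemma mpoly_induct [case_names Const Var add mult]: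
  assumes Const: "\<And>c. P (Const c)"
    and Var: "\<And>i m. m \<in> Poly_Mapping.keys f \<Longrightarrow> i \<in> Poly_Mapping.keys m \<Longrightarrow> P (Var i)"
    and add: "\<And>f g. P f \<Longrightarrow> P g \<Longrightarrow> P (f + g)"
    and mult: "\<And>f g. P f \<Longrightarrow> P g \<Longrightarrow> P (f * g)"
  shows "P f"
proof -
  have [intro]: "P (x ^ k)" if "P x" for x k
    by (induction k) (use that mult Const[of 1] in auto)
  have P_prod: "P (prod h K)" if "\<And>k. k \<in> K \<Longrightarrow> P (h k)" for h and K :: "nat set"
    using that by (induction K rule: infinite_finite_induct) (use mult Const[of 1] in auto)
  have P_sum: "P (sum h M)" if "\<And>m. m \<in> M \<Longrightarrow> P (h m)" for h and M :: "(nat \<Rightarrow>\<^sub>0 nat) set"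
    using that by (induction M rule: infinite_finite_induct) (use add Const[of 0] in auto)
  have "P (Const (Poly_Mapping.lookup f m) * eval_monom Var m)"
    if "m \<in> Poly_Mapping.keys f" for m
    unfolding eval_monom_def by (intro mult Const P_prod) (use Var that in auto)
  moreover have "Const (Poly_Mapping.lookup f m) * eval_monom Var m =
      Poly_Mapping.single m (Poly_Mapping.lookup f m)" for m
    by (simp add: eval_monom_Var Const_def mult_single)
  ultimately have "P (\<Sum>m\<in>Poly_Mapping.keys f. Poly_Mapping.single m (Poly_Mapping.lookup f m))"
    by (intro P_sum) auto
  then show ?thesis
    by (simp flip: mpoly_sum_single)
qed

lemma poly_ring_induct [consumes 1, case_names Const Var add mult]:
  assumes "f \<in> poly_ring n"
    and "\<And>c. P (Const c)" "\<And>i. i < n \<Longrightarrow> P (Var i)"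
    and "\<And>f g. P f \<Longrightarrow> P g \<Longrightarrow> P (f + g)" "\<And>f g. P f \<Longrightarrow> P g \<Longrightarrow> P (f * g)"
  shows "P f"
  by (rule mpoly_induct) (use assms in \<open>auto simp: poly_ring_def\<close>)

lemma Const_in_poly_ring [simp]: "Const c \<in> poly_ring n"
  by (auto simp: Const_def poly_ring_def)

lemma zero_in_poly_ring [simp]: "0 \<in> poly_ring n"
  by (simp add: poly_ring_def)

lemma Var_in_poly_ring [simp]: "i < n \<Longrightarrow> Var i \<in> poly_ring n"
  by (auto simp: Var_def poly_ring_def)

lemma add_in_poly_ring: "f \<in> poly_ring n \<Longrightarrow> g \<in> poly_ring n \<Longrightarrow> f + g \<in> poly_ring n"
  using Poly_Mapping.keys_add[of f g] unfolding poly_ring_def by blast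

lemma mult_in_poly_ring:
  assumes "f \<in> poly_ring n" "g \<in> poly_ring n"
  shows "f * g \<in> poly_ring n"
proof -
  have "Poly_Mapping.keys (a + b) \<subseteq> {..<n}"
    if "a \<in> Poly_Mapping.keys f" "b \<in> Poly_Mapping.keys g" for a b :: "nat \<Rightarrow>\<^sub>0 nat"
    using that assms Poly_Mapping.keys_add[of a b] unfolding poly_ring_def by blast
  then show ?thesis
    using keys_mult[of f g] unfolding poly_ring_def by blast
qed

lemma sum_in_poly_ring: "(\<And>i. i \<in> I \<Longrightarrow> f i \<in> poly_ring n) \<Longrightarrow> sum f I \<in> poly_ring n"
  by (induction I rule: infinite_finite_induct) (auto intro: add_in_poly_ring)

lemma power_in_poly_ring: "f \<in> poly_ring n \<Longrightarrow> f ^ k \<in> poly_ring n"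
  by (induction k) (use Const_in_poly_ring[of 1] in \<open>auto intro: mult_in_poly_ring\<close>)

lemma subst_poly_1 [simp]: "subst_poly s 1 = 1"
  using subst_poly_Const[of s 1] by simp

interpretation subst_poly_hom: map_poly_comm_ring_hom "subst_poly s" for s
  by unfold_locales (auto simp: subst_poly_add subst_poly_mult)

interpretation act_hom: map_poly_comm_ring_hom "act g" for g
  unfolding act_def ..

lemma subst_poly_in_poly_ring:
  assumes "f \<in> poly_ring n" "\<And>k. k < n \<Longrightarrow> s k \<in> poly_ring m"
  shows "subst_poly s f \<in> poly_ring m"
  using assms(1)
  by (induction rule: poly_ring_induct)
    (auto simp: assms subst_poly_add subst_poly_mult intro: add_in_poly_ring mult_in_poly_ring)

lemma subst_poly_cong:
  assumes "f \<in> poly_ring n" "\<And>k. k < n \<Longrightarrow> s k = t k"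
  shows "subst_poly s f = subst_poly t f"
  using assms(1)
  by (induction rule: poly_ring_induct) (auto simp: assms subst_poly_add subst_poly_mult)

lemma subst_poly_Var_id [simp]: "subst_poly Var f = f"
  by (induction f rule: mpoly_induct) (auto simp: subst_poly_add subst_poly_mult)

lemma subst_poly_subst_poly:
  "subst_poly s (subst_poly t f) = subst_poly (\<lambda>k. subst_poly s (t k)) f"
  by (induction f rule: mpoly_induct) (auto simp: subst_poly_add subst_poly_mult)

section \<open>Truncation to \<open>n\<close> variables and reduction modulo the first
  variable\<close>

definition truncate :: "nat \<Rightarrow> 'a::comm_ring_1 mpoly \<Rightarrow> 'a mpoly"
  where "truncate n = subst_poly (\<lambda>k. if k < n then Var k else 0)"

interpretation truncate_hom: map_poly_comm_ring_hom "truncate n" for n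
  unfolding truncate_def ..

text \<open>Turns membership in \<open>poly_ring n\<close> into a fixed-point equation of a ring
  homomorphism. Such an equation survives cancellation and can be read off coefficientwise, just
  like invariance under a matrix.\<close>

lemma poly_ring_iff_truncate: "f \<in> poly_ring n \<longleftrightarrow> truncate n f = f"
proof
  assume "f \<in> poly_ring n"
  then have "truncate n f = subst_poly Var f"
    unfolding truncate_def by (rule subst_poly_cong) auto
  then show "truncate n f = f" by simp
next
  have "truncate n f \<in> poly_ring n"
    unfolding truncate_def
    by (induction f rule: mpoly_induct)
      (auto simp: subst_poly_add subst_poly_mult intro: add_in_poly_ring mult_in_poly_ring)
  then show "truncate n f = f \<Longrightarrow> f \<in> poly_ring n" by simp
qed

text \<open>Reduction modulo \<open>Var 0\<close>, with the quotient ring realised as the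
  polynomials in the remaining variables.\<close>

definition kill :: "'a::comm_ring_1 mpoly \<Rightarrow> 'a mpoly"
  where "kill = subst_poly (Var(0 := 0))"

interpretation kill_hom: map_poly_comm_ring_hom kill
  unfolding kill_def ..

lemma kill_Const [simp]: "kill (Const c) = Const c"
  and kill_Var: "kill (Var i) = (if i = 0 then 0 else Var i)"
  by (auto simp: kill_def)

text \<open>By induction \<open>f - kill f\<close> is always a multiple of \<open>Var 0\<close>, so
  the kernel of \<open>kill\<close> is the ideal generated by \<open>Var 0\<close>.\<close>

lemma kill_eq_0_iff: "kill f = 0 \<longleftrightarrow> Var 0 dvd f"
proof
  have "Var 0 dvd f - kill f"
  proof (induction f rule: mpoly_induct)
    case (add f g)
    then show ?case
      by (simp add: kill_hom.base.hom_add add_diff_add)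
  next
    case (mult f g)
    have "f * g - kill (f * g) = f * (g - kill g) + (f - kill f) * kill g"
      by (simp add: algebra_simps kill_hom.base.hom_mult)
    with mult show ?case by simp
  qed (auto simp: kill_Var)
  then show "kill f = 0 \<Longrightarrow> Var 0 dvd f" by simp
next
  show "Var 0 dvd f \<Longrightarrow> kill f = 0"
    by (auto simp: dvd_def kill_hom.base.hom_mult kill_Var)
qed

text \<open>A substitution followed by \<open>kill\<close> is again a substitution, with the reduced
  images.\<close>

lemma kill_subst_poly_cong:
  assumes "f \<in> poly_ring n" "\<And>k. k < n \<Longrightarrow> kill (s k) = kill (t k)"
  shows "kill (subst_poly s f) = kill (subst_poly t f)"
  using subst_poly_cong[OF assms] by (simp add: kill_def subst_poly_subst_poly)

lemma Var_nonzero [simp]: "Var i \<noteq> 0"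
  by (metis Var_def lookup_single_eq lookup_zero zero_neq_one)

text \<open>\<open>Var 0\<close> generates the kernel of a homomorphism into an integral
  domain.\<close>

lemma prime_elem_Var_0: "prime_elem (Var 0 :: 'a::idom mpoly)"
proof (rule prime_elemI)
  show "\<not> Var 0 dvd (1 :: 'a mpoly)"
    by (simp flip: kill_eq_0_iff)
qed (auto simp flip: kill_eq_0_iff simp: kill_hom.base.hom_mult)

section \<open>Linear forms and the action of matrices\<close>

definition lin_form :: "nat \<Rightarrow> (nat \<Rightarrow> 'a) \<Rightarrow> 'a::comm_ring_1 mpoly"
  where "lin_form n c = (\<Sum>i<n. Const (c i) * Var i)"

lemma lin_form_in_poly_ring [simp]: "lin_form n c \<in> poly_ring n"
  unfolding lin_form_def by (intro sum_in_poly_ring mult_in_poly_ring) auto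

lemma lin_form_add: "lin_form n (\<lambda>i. c i + d i) = lin_form n c + lin_form n d"
  by (simp add: lin_form_def Const_add algebra_simps sum.distrib)

lemma lin_form_scale: "lin_form n (\<lambda>i. a * c i) = Const a * lin_form n c"
  by (simp add: lin_form_def Const_mult sum_distrib_left mult_ac)

lemma Var_eq_lin_form: "k < n \<Longrightarrow> Var k = lin_form n (\<lambda>i. if i = k then 1 else 0)"
  by (simp add: lin_form_def if_distrib[of Const] if_distrib[of "\<lambda>x. x * _"] cong: if_cong)

lemma lookup_lin_form:
  "Poly_Mapping.lookup (lin_form n c) (Poly_Mapping.single i 1) = (if i < n then c i else 0)"
proof -
  have "Poly_Mapping.single j (1 :: nat) = Poly_Mapping.single i 1 \<longleftrightarrow> j = i" for j
    by (metis lookup_single_eq lookup_single_not_eq zero_neq_one)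
  then show ?thesis
    by (simp add: lin_form_def Const_def Var_def mult_single lookup_sum lookup_single when_def)
qed

lemma lin_form_eq_iff: "lin_form n c = lin_form n d \<longleftrightarrow> (\<forall>i<n. c i = d i)"
proof
  assume "lin_form n c = lin_form n d"
  then show "\<forall>i<n. c i = d i"
    by (metis lookup_lin_form)
qed (simp add: lin_form_def)

lemma lin_form_eq_0_iff: "lin_form n c = 0 \<longleftrightarrow> (\<forall>i<n. c i = 0)"
  using lin_form_eq_iff[of n c "\<lambda>_. 0"] by (simp add: lin_form_def)

lemma kill_lin_form: "kill (lin_form n c) = lin_form n (c(0 := 0))"
  unfolding lin_form_def kill_hom.base.hom_sum
  by (rule sum.cong) (auto simp: kill_hom.base.hom_mult kill_Var)

lemma act_Var_lin_form: "g \<in> carrier_mat n m \<Longrightarrow> act g (Var k) = lin_form n (\<lambda>i. g $$ (i, k))"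
  by (auto simp: act_Var lin_form_def)

lemma act_subst_poly:
  "g \<in> carrier_mat n m \<Longrightarrow> act g = subst_poly (\<lambda>k. lin_form n (\<lambda>i. g $$ (i, k)))"
  by (auto simp: act_def lin_form_def)

lemma act_Const [simp]: "act g (Const c) = Const c"
  by (simp add: act_def)

lemma act_lin_form:
  assumes "g \<in> carrier_mat n m"
  shows "act g (lin_form m c) = lin_form n (\<lambda>i. \<Sum>k<m. g $$ (i, k) * c k)"
proof -
  have "act g (lin_form m c) = (\<Sum>k<m. Const (c k) * lin_form n (\<lambda>i. g $$ (i, k)))"
    by (simp add: lin_form_def[of m] act_hom.base.hom_sum act_hom.base.hom_mult
        act_Var_lin_form[OF assms])
  also have "\<dots> = (\<Sum>k<m. \<Sum>i<n. Const (g $$ (i, k) * c k) * Var i)"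
    by (simp add: lin_form_def sum_distrib_left Const_mult mult_ac)
  also have "\<dots> = lin_form n (\<lambda>i. \<Sum>k<m. g $$ (i, k) * c k)"
    by (subst sum.swap) (simp add: lin_form_def Const_sum sum_distrib_right)
  finally show ?thesis .
qed

lemma act_in_poly_ring:
  assumes "g \<in> carrier_mat n n" "f \<in> poly_ring n"
  shows "act g f \<in> poly_ring n"
  unfolding act_subst_poly[OF assms(1)] by (rule subst_poly_in_poly_ring[OF assms(2)]) simp

lemma act_mult:
  assumes g: "g \<in> carrier_mat n n" and h: "h \<in> carrier_mat n n" and f: "f \<in> poly_ring n"
  shows "act (g * h) f = act g (act h f)"
proof -
  have gh: "g * h \<in> carrier_mat n n"
    using g h by simp
  have "act g (act h f) = subst_poly (\<lambda>k. act g (lin_form n (\<lambda>i. h $$ (i, k)))) f"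
    unfolding act_subst_poly[OF g] act_subst_poly[OF h] subst_poly_subst_poly ..
  also have "\<dots> = act (g * h) f"
    unfolding act_subst_poly[OF gh]
  proof (rule subst_poly_cong[OF f])
    fix k assume "k < n"
    then have "(g * h) $$ (i, k) = (\<Sum>j<n. g $$ (i, j) * h $$ (j, k))" if "i < n" for i
      using g h that by (simp add: scalar_prod_def lessThan_atLeast0)
    then show "act g (lin_form n (\<lambda>i. h $$ (i, k))) = lin_form n (\<lambda>i. (g * h) $$ (i, k))"
      by (simp add: act_lin_form[OF g] lin_form_eq_iff)
  qed
  finally show ?thesis by simp
qed

lemma act_one:
  assumes "f \<in> poly_ring n"
  shows "act (1\<^sub>m n) f = f"
proof -
  have "act (1\<^sub>m n) f = subst_poly Var f"
    unfolding act_subst_poly[OF one_carrier_mat]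
    by (rule subst_poly_cong[OF assms]) (auto simp: Var_eq_lin_form[of _ n] lin_form_eq_iff)
  then show ?thesis by simp
qed

section \<open>The general linear and the parabolic group\<close>

lemma GL_iff_det:
  fixes g :: "'a::field mat"
  shows "g \<in> GL n \<longleftrightarrow> g \<in> carrier_mat n n \<and> det g \<noteq> 0"
proof (intro iffI conjI)
  assume g: "g \<in> GL n"
  then show g_carrier: "g \<in> carrier_mat n n" by (simp add: GL_def)
  from g obtain h where gh: "g * h = 1\<^sub>m n" and hg: "h * g = 1\<^sub>m (dim_row h)"
    by (auto simp: GL_def invertible_mat_def inverts_mat_def)
  have "h \<in> carrier_mat n n"
    using arg_cong[OF gh, of dim_col] arg_cong[OF hg, of dim_col] g_carrier by auto
  then show "det g \<noteq> 0"
    using arg_cong[OF gh, of det] det_mult[OF g_carrier, of h] by auto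
next
  assume g: "g \<in> carrier_mat n n \<and> det g \<noteq> 0"
  then have "g \<in> Units (ring_mat TYPE('a) n ())"
    by (intro det_non_zero_imp_unit) auto
  then obtain h where "h \<in> carrier_mat n n" "h * g = 1\<^sub>m n" "g * h = 1\<^sub>m n"
    by (auto simp: Units_def ring_mat_simps)
  with g show "g \<in> GL n"
    by (auto simp: GL_def invertible_mat_def inverts_mat_def)
qed

lemma GL_carrier: "g \<in> GL n \<Longrightarrow> g \<in> carrier_mat n n"
  by (simp add: GL_def)

lemma GL_mult:
  fixes g h :: "'a::field mat"
  shows "g \<in> GL n \<Longrightarrow> h \<in> GL n \<Longrightarrow> g * h \<in> GL n"
  by (auto simp: GL_iff_det det_mult)

lemma GL_inverse:
  fixes g :: "'a::field mat"
  assumes "g \<in> GL n"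
  obtains h where "h \<in> GL n" "h * g = 1\<^sub>m n" "g * h = 1\<^sub>m n"
proof -
  have "g \<in> Units (ring_mat TYPE('a) n ())"
    using assms by (intro det_non_zero_imp_unit) (auto simp: GL_iff_det)
  then obtain h where h: "h \<in> carrier_mat n n" "h * g = 1\<^sub>m n" "g * h = 1\<^sub>m n"
    by (auto simp: Units_def ring_mat_simps)
  then have "h \<in> GL n"
    using assms by (auto simp: GL_def invertible_mat_def inverts_mat_def)
  with h show thesis using that by blast
qed

lemma GL_act_inverse:
  fixes g :: "'a::field mat"
  assumes "g \<in> GL n"
  obtains h where "h \<in> GL n" "\<And>f. f \<in> poly_ring n \<Longrightarrow> act h (act g f) = f"
    "\<And>f. f \<in> poly_ring n \<Longrightarrow> act g (act h f) = f"
proof -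
  obtain h where h: "h \<in> GL n" "h * g = 1\<^sub>m n" "g * h = 1\<^sub>m n"
    using GL_inverse[OF assms] .
  then show thesis
    using that assms by (metis GL_carrier act_mult act_one)
qed

lemma parabolic_subset_GL: "parabolic k l \<subseteq> (GL (k + l) :: 'a::field mat set)"
proof
  fix g :: "'a mat" assume "g \<in> parabolic k l"
  then obtain A B C where g: "g = four_block_mat A C (0\<^sub>m l k) B"
    "A \<in> GL k" "B \<in> GL l" "C \<in> carrier_mat k l"
    by (auto simp: parabolic_def)
  then show "g \<in> GL (k + l)"
    using det_four_block_mat_lower_left_zero[of A k C l "0\<^sub>m l k" B] by (auto simp: GL_iff_det)
qed

text \<open>For the converse, the determinant of a block triangular matrix is the product of those
  of the diagonal blocks, so both blocks of an invertible \<open>g\<close> are invertible.\<close>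

lemma parabolic_1_iff:
  fixes g :: "'a::field mat"
  shows "g \<in> parabolic 1 m \<longleftrightarrow> g \<in> GL (Suc m) \<and> (\<forall>i. 0 < i \<and> i < Suc m \<longrightarrow> g $$ (i, 0) = 0)"
proof (intro iffI conjI allI impI)
  assume "g \<in> parabolic 1 m"
  then show "g \<in> GL (Suc m)"
    using parabolic_subset_GL[of 1 m] by auto
  fix i assume "0 < i \<and> i < Suc m"
  then show "g $$ (i, 0) = 0"
    using \<open>g \<in> parabolic 1 m\<close> by (auto simp: parabolic_def GL_def)
next
  assume *: "g \<in> GL (Suc m) \<and> (\<forall>i. 0 < i \<and> i < Suc m \<longrightarrow> g $$ (i, 0) = 0)"
  obtain A C D B where split: "split_block g 1 1 = (A, C, D, B)"
    by (cases "split_block g 1 1") auto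
  have g: "g \<in> carrier_mat (1 + m) (1 + m)"
    using * by (auto simp: GL_def)
  note blocks = split_block[OF split, of m m]
  have carriers: "A \<in> carrier_mat 1 1" "C \<in> carrier_mat 1 m" "D \<in> carrier_mat m 1"
    "B \<in> carrier_mat m m" and eq: "g = four_block_mat A C D B"
    using blocks g by auto
  have D: "D = 0\<^sub>m m 1"
    using split * g by (auto simp: split_block_def Let_def intro!: eq_matI)
  have "det g = det A * det B"
    unfolding eq using carriers D by (intro det_four_block_mat_lower_left_zero) auto
  with * carriers have "A \<in> GL 1" "B \<in> GL m"
    by (auto simp: GL_iff_det)
  with eq carriers D show "g \<in> parabolic 1 m"
    unfolding parabolic_def by blast
qed

text \<open>For \<open>i < n\<close>, the columns after the first are the unit vectors other than
  the \<open>i\<close>-th. They complete \<open>c\<close> to a basis as soon as \<open>c i\<close>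
  is nonzero.\<close>

definition completion :: "nat \<Rightarrow> (nat \<Rightarrow> 'a::comm_ring_1) \<Rightarrow> nat \<Rightarrow> 'a mat"
  where "completion n c i = mat n n (\<lambda>(r, k). if k = 0 then c r
    else if k = i then (if r = 0 then 1 else 0) else (if r = k then 1 else 0))"

lemma completion_carrier [simp]: "completion n c i \<in> carrier_mat n n"
  by (simp add: completion_def)

lemma completion_in_GL:
  fixes c :: "nat \<Rightarrow> 'a::field"
  assumes "i < n" "c i \<noteq> 0"
  shows "completion n c i \<in> GL n"
proof -
  have "w = 0\<^sub>v n" if w: "w \<in> carrier_vec n" and eq: "completion n c i *\<^sub>v w = 0\<^sub>v n" for w
  proof -
    let ?G = "\<lambda>r k. completion n c i $$ (r, k)"
    have row: "(\<Sum>k<n. ?G r k * w $ k) = 0" if "r < n" for r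
    proof -
      have "(completion n c i *\<^sub>v w) $ r = (\<Sum>k<n. ?G r k * w $ k)"
        using w that by (simp add: completion_def scalar_prod_def lessThan_atLeast0)
      with eq that show ?thesis by simp
    qed
    have row': "c r * w $ 0 + (\<Sum>k\<in>{0<..<n}. ?G r k * w $ k) = 0" if "r < n" for r
    proof -
      have "{..<n} = insert 0 {0<..<n}" using that by auto
      with row[OF that] show ?thesis using that by (simp add: completion_def)
    qed
    \<comment> \<open>Row \<open>i\<close> meets only the column \<open>c\<close>, so it isolates
      \<open>c i * w $ 0\<close>.\<close>
    have "(\<Sum>k\<in>{0<..<n}. ?G i k * w $ k) = 0"
      using assms by (intro sum.neutral) (auto simp: completion_def)
    with row'[of i] assms have w0: "w $ 0 = 0" by simp
    have w_r: "w $ r = 0" if "0 < r" "r < n" "r \<noteq> i" for r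
    proof -
      have "(\<Sum>k\<in>{0<..<n}. ?G r k * w $ k) = (\<Sum>k\<in>{0<..<n}. if k = r then w $ k else 0)"
        using that by (intro sum.cong) (auto simp: completion_def)
      with row'[of r] w0 that show ?thesis by simp
    qed
    \<comment> \<open>Column \<open>i\<close> holds the unit vector of index 0, so this entry is
      read off row 0.\<close>
    have "w $ i = 0" if "0 < i"
    proof -
      have "(\<Sum>k\<in>{0<..<n}. ?G 0 k * w $ k) = (\<Sum>k\<in>{0<..<n}. if k = i then w $ k else 0)"
        by (intro sum.cong) (auto simp: completion_def)
      with row'[of 0] w0 that assms show ?thesis by simp
    qed
    with w0 w_r have "w $ r = 0" if "r < n" for r
      using that by (metis gr0I)
    with w show ?thesis by (intro eq_vecI) auto
  qed
  then have "det (completion n c i) \<noteq> 0"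
    using det_0_iff_vec_prod_zero[OF completion_carrier] by metis
  then show ?thesis
    by (simp add: GL_iff_det)
qed

lemma act_completion_Var_0:
  "0 < n \<Longrightarrow> act (completion n c i) (Var 0) = lin_form n c"
  by (simp add: act_Var_lin_form[OF completion_carrier] lin_form_eq_iff)
    (simp add: completion_def)

section \<open>Nonzero linear forms as one orbit\<close>

definition nonzero_forms :: "nat \<Rightarrow> 'a::comm_ring_1 mpoly set"
  where "nonzero_forms n = range (lin_form n) - {0}"

lemma nonzero_formsE:
  assumes "v \<in> nonzero_forms n"
  obtains c i where "v = lin_form n c" "i < n" "c i \<noteq> 0"
  using assms by (auto simp: nonzero_forms_def lin_form_eq_0_iff)

lemma zero_notin_nonzero_forms [simp]: "0 \<notin> nonzero_forms n"
  by (simp add: nonzero_forms_def)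

lemma nonzero_forms_in_poly_ring: "v \<in> nonzero_forms n \<Longrightarrow> v \<in> poly_ring n"
  by (auto simp: nonzero_forms_def)

lemma Var_in_nonzero_forms: "i < n \<Longrightarrow> Var i \<in> nonzero_forms n"
  by (auto simp: nonzero_forms_def Var_eq_lin_form[of i n] lin_form_eq_0_iff)

lemma scale_in_nonzero_forms:
  fixes a :: "'a::idom"
  shows "a \<noteq> 0 \<Longrightarrow> v \<in> nonzero_forms n \<Longrightarrow> Const a * v \<in> nonzero_forms n"
  by (auto simp: nonzero_forms_def simp flip: lin_form_scale)

text \<open>Complete the coefficient vector of \<open>v\<close> to an invertible matrix with that
  vector as first column.\<close>

lemma nonzero_forms_transitive:
  fixes v :: "'a::field mpoly"
  assumes "v \<in> nonzero_forms n"
  obtains g where "g \<in> GL n" "act g (Var 0) = v"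
proof -
  obtain c i where "v = lin_form n c" "i < n" "c i \<noteq> 0"
    using assms by (rule nonzero_formsE)
  then show thesis
    using that completion_in_GL[of i n c] act_completion_Var_0[of n c i] by auto
qed

text \<open>\<open>lin_form n\<close> ignores coefficients from index \<open>n\<close> on. Taking
  extensional functions makes the coefficient vector unique, so that the forms can be
  counted.\<close>

lemma nonzero_forms_bij_betw_coeffs:
  "bij_betw (lin_form n) (({..<n} \<rightarrow>\<^sub>E UNIV) - {\<lambda>i\<in>{..<n}. 0})
     (nonzero_forms n :: 'a::comm_ring_1 mpoly set)"
proof (rule bij_betw_imageI)
  show inj: "inj_on (lin_form n) (({..<n} \<rightarrow>\<^sub>E UNIV) - {\<lambda>i\<in>{..<n}. 0})"
    by (rule inj_onI) (auto simp: lin_form_eq_iff intro: PiE_ext)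
  show "lin_form n ` (({..<n} \<rightarrow>\<^sub>E UNIV) - {\<lambda>i\<in>{..<n}. 0}) =
      (nonzero_forms n :: 'a mpoly set)" (is "?l = ?r")
  proof (intro equalityI subsetI)
    fix v assume "v \<in> ?l"
    then obtain c where c: "v = lin_form n c" "c \<in> {..<n} \<rightarrow>\<^sub>E UNIV" "c \<noteq> (\<lambda>i\<in>{..<n}. 0)"
      by auto
    have "c = (\<lambda>i\<in>{..<n}. 0)" if "\<forall>i<n. c i = 0"
      using that c(2) by (intro ext) (auto simp: restrict_def dest: PiE_arb)
    with c(3) have "lin_form n c \<noteq> 0"
      by (auto simp: lin_form_eq_0_iff)
    with c show "v \<in> ?r"
      by (auto simp: nonzero_forms_def)
  next
    fix v :: "'a mpoly" assume "v \<in> ?r"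
    then obtain c i where c: "v = lin_form n c" "i < n" "c i \<noteq> 0"
      by (rule nonzero_formsE)
    have "v = lin_form n (\<lambda>i\<in>{..<n}. c i)"
      using c by (simp add: lin_form_eq_iff)
    moreover have "(\<lambda>i\<in>{..<n}. c i) \<noteq> (\<lambda>i\<in>{..<n}. 0)"
      using c by (metis lessThan_iff restrict_apply')
    ultimately show "v \<in> ?l" by auto
  qed
qed

lemma finite_nonzero_forms [simp]: "finite (nonzero_forms n :: 'a::{comm_ring_1,finite} mpoly set)"
  using bij_betw_finite[OF nonzero_forms_bij_betw_coeffs[of n, where 'a='a]]
  by (simp add: finite_PiE)

lemma card_nonzero_forms:
  "card (nonzero_forms n :: 'a::{comm_ring_1,finite} mpoly set) = CARD('a) ^ n - 1"
  using bij_betw_same_card[OF nonzero_forms_bij_betw_coeffs[of n, where 'a='a]]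
  by (simp add: card_PiE finite_PiE)

lemma act_nonzero_forms_subset:
  fixes g :: "'a::field mat"
  assumes "g \<in> GL n"
  shows "act g ` nonzero_forms n \<subseteq> nonzero_forms n"
proof clarify
  fix v :: "'a mpoly" assume v: "v \<in> nonzero_forms n"
  obtain h where "act h (act g v) = v"
    using GL_act_inverse[OF assms] nonzero_forms_in_poly_ring[OF v] by metis
  with v show "act g v \<in> nonzero_forms n"
    using GL_carrier[OF assms] by (auto simp: nonzero_forms_def act_lin_form)
qed

lemma bij_betw_act_nonzero_forms:
  fixes g :: "'a::field mat"
  assumes "g \<in> GL n"
  shows "bij_betw (act g) (nonzero_forms n) (nonzero_forms n)"
proof -
  obtain h where h: "h \<in> GL n" "\<And>f. f \<in> poly_ring n \<Longrightarrow> act h (act g f) = f"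
    "\<And>f. f \<in> poly_ring n \<Longrightarrow> act g (act h f) = f"
    using GL_act_inverse[OF assms] by blast
  show ?thesis
    by (rule bij_betw_byWitness[where f' = "act h"])
      (use h act_nonzero_forms_subset[OF assms] act_nonzero_forms_subset[OF h(1)]
        in \<open>simp_all add: nonzero_forms_in_poly_ring\<close>)
qed

section \<open>Finite fields and products of primes\<close>

text \<open>Uniqueness of interpolation: a nonzero difference would have more roots than its degree.
  It yields the symmetries of the interpolant as well as linear independence.\<close>

lemma poly_eqI_degree_roots:
  fixes F G :: "'a::idom poly"
  assumes "\<And>x. x \<in> A \<Longrightarrow> poly F x = poly G x" "degree F < card A" "degree G < card A"
  shows "F = G"
proof (rule ccontr)
  assume "F \<noteq> G"
  then have "card A \<le> card {x. poly (F - G) x = 0}"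
    using assms(1) by (intro card_mono poly_roots_finite) auto
  also have "\<dots> \<le> degree (F - G)"
    using \<open>F \<noteq> G\<close> by (intro card_poly_roots_bound) simp
  finally show False
    using assms degree_diff_le_max[of F G] by linarith
qed

lemma finite_field_power_minus_1:
  fixes a :: "'a::finite_field"
  assumes "a \<noteq> 0"
  shows "a ^ (CARD('a) - 1) = 1"
proof -
  have "a * a ^ (CARD('a) - 1) = a * 1"
    using finite_field_power_card_eq_same[of a] zero_less_card_finite[where 'a='a]
    by (simp flip: power_Suc)
  with assms show ?thesis by simp
qed

lemma card_field_ge_2: "CARD('a::finite_field) \<ge> 2"
proof -
  have "card {0, 1 :: 'a} \<le> CARD('a)"
    by (intro card_mono) auto
  then show ?thesis by simp
qed

lemma card_minus_1_dvd:
  assumes "\<And>a :: 'a::finite_field. a \<noteq> 0 \<Longrightarrow> a ^ k = 1"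
  shows "(CARD('a) - 1) dvd k"
proof (rule ccontr)
  define q where "q = CARD('a) - 1"
  define r where "r = k mod q"
  assume "\<not> (CARD('a) - 1) dvd k"
  then have "r > 0" "r < q"
    using card_field_ge_2[where 'a='a] by (auto simp: r_def q_def dvd_eq_mod_eq_0)
  have root: "a ^ r = 1" if "a \<noteq> 0" for a :: 'a
  proof -
    have "a ^ k = (a ^ q) ^ (k div q) * a ^ r"
      by (simp add: r_def flip: power_mult power_add)
    with assms[OF that] finite_field_power_minus_1[OF that] show ?thesis
      by (simp add: q_def)
  qed
  have "Polynomial.monom (1 :: 'a) r = 1"
  proof (rule poly_eqI_degree_roots[of "UNIV - {0}"])
    show "degree (Polynomial.monom (1 :: 'a) r) < card (UNIV - {0 :: 'a})"
      using \<open>r < q\<close> by (simp add: degree_monom_eq q_def card_Diff_singleton)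
    then show "degree (1 :: 'a poly) < card (UNIV - {0 :: 'a})"
      by simp
  qed (auto simp: poly_monom root)
  then have "degree (Polynomial.monom (1 :: 'a) r) = 0"
    by simp
  with \<open>r > 0\<close> show False
    by (simp add: degree_monom_eq)
qed

text \<open>The shift by 1 permutes the field; compare the sums of all elements before and
  after.\<close>

lemma of_nat_card_finite_field: "of_nat CARD('a) = (0 :: 'a::finite_field)"
proof -
  have "bij (\<lambda>x :: 'a. x + 1)"
    by (rule bij_betw_byWitness[where f' = "\<lambda>x. x - 1"]) auto
  then have "(\<Sum>x\<in>UNIV. x + 1) = (\<Sum>x\<in>UNIV. x :: 'a)"
    by (rule sum.reindex_bij_betw)
  then show ?thesis
    by (simp add: sum.distrib)
qed

text \<open>Members of \<open>A\<close> may be associates, so the exponent counts the whole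
  associate class of \<open>v\<close>. When \<open>v\<close> joins \<open>A\<close>, the product
  over \<open>A\<close> contains \<open>v\<close> exactly \<open>card K\<close> times, and the one
  further factor \<open>v\<close> of \<open>s\<close> must divide the cofactor
  \<open>t\<close>.\<close>

lemma prod_primes_dvd:
  fixes s :: "'a::idom"
  assumes "finite A" "\<And>v. v \<in> A \<Longrightarrow> prime_elem v"
    and "\<And>u v. u \<in> A \<Longrightarrow> v \<in> A \<Longrightarrow> v dvd u \<Longrightarrow> u dvd v"
    and "\<And>v. v \<in> A \<Longrightarrow> v ^ card {u \<in> A. v dvd u} dvd s"
  shows "\<Prod>A dvd s"
  using assms
proof (induction A rule: finite_induct)
  case (insert v A)
  have "w ^ card {u \<in> A. w dvd u} dvd s" if "w \<in> A" for w
  proof -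
    have "card {u \<in> A. w dvd u} \<le> card {u \<in> insert v A. w dvd u}"
      using insert.hyps by (intro card_mono) auto
    then have "w ^ card {u \<in> A. w dvd u} dvd w ^ card {u \<in> insert v A. w dvd u}"
      by (rule le_imp_power_dvd)
    also have "\<dots> dvd s"
      using insert.prems(3) that by simp
    finally show ?thesis .
  qed
  then have "\<Prod>A dvd s"
    using insert.prems(1,2) by (intro insert.IH) blast+
  then obtain t where t: "s = \<Prod>A * t" ..
  define K where "K = {u \<in> A. v dvd u}"
  have v: "prime_elem v" using insert.prems by auto
  then have "v \<noteq> 0" by auto
  have not_dvd_prod: "\<not> v dvd prod h B" if "finite B" "\<And>u. u \<in> B \<Longrightarrow> \<not> v dvd h u"
    for B and h :: "'a \<Rightarrow> 'a"
    using that
  proof (induction B rule: finite_induct)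
    case empty
    with v show ?case by (simp add: prime_elem_def)
  next
    case (insert x F)
    with v show ?case by (auto simp: prime_elem_dvd_mult_iff)
  qed
  define h where "h u = (SOME x. u = v * x)" for u
  have h: "u = v * h u" "\<not> v dvd h u" if "u \<in> K" for u
  proof -
    from that have "u \<in> A" "v dvd u" by (auto simp: K_def)
    then show *: "u = v * h u"
      unfolding h_def by (metis (mono_tags) dvdE someI)
    \<comment> \<open>Members of \<open>K\<close> are associates of \<open>v\<close>, so
      \<open>v * v\<close> dividing \<open>u\<close> would divide \<open>v\<close>.\<close>
    show "\<not> v dvd h u"
    proof
      assume "v dvd h u"
      then have "v * v dvd u" by (subst *) auto
      moreover have "u dvd v"
        using insert.prems(2) \<open>u \<in> A\<close> \<open>v dvd u\<close> by auto
      ultimately have "v * v dvd v * 1"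
        by (metis dvd_trans mult.right_neutral)
      with \<open>v \<noteq> 0\<close> have "v dvd 1"
        by (simp only: dvd_mult_cancel_left) simp
      with v show False
        by (simp add: prime_elem_def)
    qed
  qed
  have "\<Prod>K = (\<Prod>u\<in>K. v * h u)"
    by (intro prod.cong refl h)
  also have "\<dots> = v ^ card K * prod h K"
    by (simp add: prod.distrib)
  finally have prod_K: "\<Prod>K = v ^ card K * prod h K" .
  have "finite K" using insert.hyps by (simp add: K_def)
  have "{u \<in> insert v A. v dvd u} = insert v K"
    by (auto simp: K_def)
  then have "card {u \<in> insert v A. v dvd u} = Suc (card K)"
    using insert.hyps \<open>finite K\<close> by (simp add: K_def)
  then have "v ^ Suc (card K) dvd s"
    using insert.prems(3)[of v] by simp
  also have "s = \<Prod>K * \<Prod>(A - K) * t"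
    using prod.subset_diff[of K A "\<lambda>x. x"] insert.hyps by (simp add: t K_def mult.commute)
  also have "\<dots> = v ^ card K * (prod h K * \<Prod>(A - K) * t)"
    by (simp add: prod_K mult_ac)
  \<comment> \<open>After cancelling \<open>v ^ card K\<close> one factor \<open>v\<close> is left
    over; neither product can absorb it.\<close>
  finally have "v dvd prod h K * \<Prod>(A - K) * t"
    using \<open>v \<noteq> 0\<close> by (simp only: power_Suc2 dvd_mult_cancel_left) simp
  moreover have "\<not> v dvd prod h K"
    using \<open>finite K\<close> h by (intro not_dvd_prod) auto
  moreover have "\<not> v dvd \<Prod>(A - K)"
    using insert.hyps by (intro not_dvd_prod) (auto simp: K_def)
  ultimately have "v dvd t"
    using v by (simp add: prime_elem_dvd_mult_iff)
  then have "v * \<Prod>A dvd t * \<Prod>A"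
    by (rule mult_dvd_mono) simp
  then show ?case
    using insert.hyps by (simp add: t mult.commute)
qed auto

section \<open>Divisibility of Dickson invariants\<close>

text \<open>Truncation fixes \<open>f\<close> and \<open>f * g\<close>; cancelling \<open>f\<close>
  shows that it fixes \<open>g\<close>.\<close>

lemma quotient_in_poly_ring:
  fixes f g :: "'a::idom mpoly"
  assumes "f * g \<in> poly_ring n" "f \<in> poly_ring n" "f \<noteq> 0"
  shows "g \<in> poly_ring n"
proof -
  have "f * truncate n g = f * g"
    using assms by (simp add: poly_ring_iff_truncate truncate_hom.base.hom_mult)
  with assms(3) show ?thesis
    by (simp add: poly_ring_iff_truncate)
qed

text \<open>Transitivity moves \<open>v\<close> to \<open>Var 0\<close>. A form divisible by
  \<open>Var 0\<close> vanishes under \<open>kill\<close>, hence has no coefficient other than that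
  of \<open>Var 0\<close>.\<close>

lemma nonzero_forms_dvd:
  fixes u v :: "'a::field mpoly"
  assumes u: "u \<in> nonzero_forms n" and v: "v \<in> nonzero_forms n" and "v dvd u"
  obtains a where "a \<noteq> 0" "u = Const a * v"
proof -
  obtain g where g: "g \<in> GL n" "act g (Var 0) = v"
    using nonzero_forms_transitive[OF v] .
  obtain h where h: "h \<in> GL n" "\<And>f. f \<in> poly_ring n \<Longrightarrow> act h (act g f) = f"
    "\<And>f. f \<in> poly_ring n \<Longrightarrow> act g (act h f) = f"
    using GL_act_inverse[OF g(1)] by blast
  from v have "0 < n"
    by (auto elim: nonzero_formsE)
  then have "act h v = Var 0"
    using h(2)[of "Var 0"] g(2) by simp
  with \<open>v dvd u\<close> have "Var 0 dvd act h u"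
    by (metis act_hom.base.hom_dvd)
  moreover have "act h u \<in> nonzero_forms n"
    using act_nonzero_forms_subset[OF h(1)] u by auto
  then obtain c i where c: "act h u = lin_form n c" "i < n" "c i \<noteq> 0"
    by (rule nonzero_formsE)
  ultimately have "\<forall>j<n. j \<noteq> 0 \<longrightarrow> c j = 0"
    by (auto simp: kill_lin_form lin_form_eq_0_iff fun_upd_def simp flip: kill_eq_0_iff)
  with c \<open>0 < n\<close> have "c 0 \<noteq> 0" "act h u = Const (c 0) * Var 0"
    by (metis, simp add: Var_eq_lin_form[of 0 n] lin_form_eq_iff flip: lin_form_scale)
  moreover have "u = act g (act h u)"
    using h(3)[OF nonzero_forms_in_poly_ring[OF u]] by simp
  ultimately show thesis
    using that[of "c 0"] g(2) by (simp add: act_hom.base.hom_mult)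
qed

text \<open>
  \<open>act g\<close> is invertible on \<open>poly_ring n\<close> only, so primality in the whole polynomial ring is
  transported by the automorphism that agrees with \<open>act g\<close> there and fixes the other variables.
\<close>

lemma prime_elem_nonzero_forms:
  fixes v :: "'a::field mpoly"
  assumes "v \<in> nonzero_forms n"
  shows "prime_elem v"
proof -
  define E :: "'a mat \<Rightarrow> 'a mpoly \<Rightarrow> 'a mpoly"
    where "E g = subst_poly (\<lambda>k. if k < n then act g (Var k) else Var k)" for g
  interpret E: comm_ring_hom "E g" for g
    unfolding E_def by (rule subst_poly_hom.base.comm_ring_hom_axioms)
  have E_act: "E g f = act g f" if "f \<in> poly_ring n" for f g
    unfolding E_def act_def by (rule subst_poly_cong[OF that]) simp
  obtain g where g: "g \<in> GL n" "act g (Var 0) = v"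
    using nonzero_forms_transitive[OF assms] .
  obtain h where h: "h \<in> GL n" "\<And>f. f \<in> poly_ring n \<Longrightarrow> act h (act g f) = f"
    "\<And>f. f \<in> poly_ring n \<Longrightarrow> act g (act h f) = f"
    using GL_act_inverse[OF g(1)] by blast
  have E_inverse: "E x (E y f) = f"
    if "y \<in> GL n" "\<And>f. f \<in> poly_ring n \<Longrightarrow> act x (act y f) = f" for x y f
  proof -
    have "E x (if k < n then act y (Var k) else Var k) = Var k" for k
    proof (cases "k < n")
      case True
      then have "act y (Var k) \<in> poly_ring n"
        using that(1) by (intro act_in_poly_ring GL_carrier) auto
      with True show ?thesis
        by (simp add: E_act that(2))
    qed (simp add: E_def)
    then show ?thesis
      by (simp add: E_def[of y] E_def[of x] subst_poly_subst_poly)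
  qed
  have "0 < n"
    using assms by (auto elim: nonzero_formsE)
  then have v: "v = E g (Var 0)"
    using g(2) by (simp add: E_act)
  have dvd_iff: "v dvd f \<longleftrightarrow> Var 0 dvd E h f" for f
    unfolding v by (metis E.hom_dvd E_inverse g(1) h)
  note prime = prime_elem_Var_0[where 'a='a]
  show ?thesis
  proof (rule prime_elemI)
    show "v \<noteq> 0"
      using assms by (simp add: nonzero_forms_def)
    show "\<not> v dvd 1"
      using prime by (simp add: dvd_iff prime_elem_def)
    show "v dvd a \<or> v dvd b" if "v dvd a * b" for a b
      using that prime by (simp add: dvd_iff E.hom_mult prime_elem_dvd_mult_iff)
  qed
qed

lemma act_prod_nonzero_forms:
  fixes g :: "'a::field mat"
  assumes "g \<in> GL n"
  shows "act g (\<Prod>(nonzero_forms n)) = \<Prod>(nonzero_forms n)"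
  using prod.reindex_bij_betw[OF bij_betw_act_nonzero_forms[OF assms], of "\<lambda>x. x"]
  by (simp add: act_hom.base.hom_prod)

lemma prod_nonzero_forms_in_poly_ring: "\<Prod>(nonzero_forms n) \<in> poly_ring n"
proof -
  \<comment> \<open>Over an infinite ring the set of forms may be infinite; its product then has the
    default value 1.\<close>
  have "\<Prod>A \<in> poly_ring n" if "A \<subseteq> nonzero_forms n" for A :: "'a::comm_ring_1 mpoly set"
    using that
  proof (induction A rule: infinite_finite_induct)
    case (insert v A)
    then show ?case by (auto intro: mult_in_poly_ring nonzero_forms_in_poly_ring)
  qed (use Const_in_poly_ring[of 1 n] in auto)
  then show ?thesis by blast
qed

lemma prod_nonzero_forms_nonzero: "\<Prod>(nonzero_forms n) \<noteq> (0 :: 'a::finite_field mpoly)"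
  by simp

text \<open>The diagonal matrix with entries \<open>a\<close>, 1, ..., 1. It multiplies
  \<open>Var 0\<close> by \<open>a\<close> and acts trivially modulo \<open>Var 0\<close>.\<close>

definition scale_first :: "nat \<Rightarrow> 'a::comm_ring_1 \<Rightarrow> 'a mat"
  where "scale_first n a = completion n (\<lambda>i. if i = 0 then a else 0) 0"

lemma scale_first_in_parabolic:
  fixes a :: "'a::field"
  assumes "0 < n" "a \<noteq> 0"
  shows "scale_first n a \<in> parabolic 1 (n - 1)"
  unfolding parabolic_1_iff scale_first_def
  using assms completion_in_GL[of 0 n "\<lambda>i. if i = 0 then a else 0"]
  by (auto simp: completion_def)

lemma act_scale_first_Var_0: "0 < n \<Longrightarrow> act (scale_first n a) (Var 0) = Const a * Var 0"
  by (simp add: scale_first_def act_completion_Var_0)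
    (simp add: Var_eq_lin_form[of 0 n] lin_form_eq_iff flip: lin_form_scale)

lemma kill_act_scale_first:
  assumes "f \<in> poly_ring n"
  shows "kill (act (scale_first n a) f) = kill f"
proof -
  have carrier: "scale_first n a \<in> carrier_mat n n"
    by (simp add: scale_first_def)
  have "kill (act (scale_first n a) f) = kill (subst_poly Var f)"
    unfolding act_subst_poly[OF carrier]
  proof (rule kill_subst_poly_cong[OF assms])
    fix k assume "k < n"
    then show "kill (lin_form n (\<lambda>i. scale_first n a $$ (i, k))) = kill (Var k)"
      by (simp add: Var_eq_lin_form[of k n] kill_lin_form lin_form_eq_iff)
        (simp add: scale_first_def completion_def)
  qed
  then show ?thesis by simp
qed

lemma Dickson_subset_parabolic_invariants:
  "0 < n \<Longrightarrow> Dickson n \<subseteq> (parabolic_invariants 1 (n - 1) :: 'a::field mpoly set)"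
  using parabolic_subset_GL[of 1 "n - 1", where 'a='a]
  by (auto simp: Dickson_def parabolic_invariants_def invariants_def)

text \<open>Raise the exponent one at a time. For \<open>s = Var 0 ^ Suc j * t\<close>, invariance
  under \<open>scale_first n a\<close> and reduction modulo \<open>Var 0\<close> give
  \<open>a ^ Suc j * kill t = kill t\<close>, so \<open>kill t\<close> vanishes for a suitable
  \<open>a\<close>.\<close>

lemma Dickson_Var_0_power_dvd:
  fixes s :: "'a::finite_field mpoly"
  assumes s: "s \<in> Dickson n" and "0 < n" and "Var 0 dvd s"
  shows "Var 0 ^ (CARD('a) - 1) dvd s"
proof -
  have "Var 0 ^ Suc j dvd s" if "j < CARD('a) - 1" for j
    using that
  proof (induction j)
    case 0
    then show ?case using \<open>Var 0 dvd s\<close> by simp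
  next
    case (Suc j)
    then obtain t where t: "s = Var 0 ^ Suc j * t"
      by auto
    have t_ring: "t \<in> poly_ring n"
      by (rule quotient_in_poly_ring[of "Var 0 ^ Suc j"])
        (use s \<open>0 < n\<close> in \<open>auto simp: t[symmetric] Dickson_def invariants_def simp del: power_Suc
          intro: power_in_poly_ring\<close>)
    \<comment> \<open>\<open>Suc j\<close> is positive and below \<open>CARD('a) - 1\<close>, hence
      not a multiple of it.\<close>
    obtain a :: 'a where a: "a \<noteq> 0" "a ^ Suc j \<noteq> 1"
      using card_minus_1_dvd[of "Suc j", where 'a='a] Suc.prems
      by (metis dvd_imp_le not_less zero_less_Suc)
    let ?d = "scale_first n a"
    have "?d \<in> GL n"
      using scale_first_in_parabolic[OF \<open>0 < n\<close> a(1)] parabolic_subset_GL[of 1 "n - 1"] \<open>0 < n\<close>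
      by auto
    with s have "act ?d s = s"
      by (simp add: Dickson_def invariants_def)
    then have "Var 0 ^ Suc j * (Const (a ^ Suc j) * act ?d t) = Var 0 ^ Suc j * t"
      unfolding t act_hom.base.hom_mult act_hom.base.hom_power act_scale_first_Var_0[OF \<open>0 < n\<close>]
      by (simp add: Const_power power_mult_distrib Const_mult mult_ac)
    then have "Const (a ^ Suc j) * act ?d t = t"
      by (simp del: power_Suc)
    then have "Const (a ^ Suc j) * kill t = kill t"
      by (metis kill_Const kill_act_scale_first kill_hom.base.hom_mult t_ring)
    then have "(Const (a ^ Suc j) - 1) * kill t = 0"
      by (simp add: algebra_simps)
    then have "Var 0 dvd t"
      using a(2) by (simp add: kill_eq_0_iff del: power_Suc)
    then show ?case
      unfolding t power_Suc2[of _ "Suc j"] by (intro mult_dvd_mono) auto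
  qed
  from this[of "CARD('a) - 2"] show ?thesis
    using card_field_ge_2[where 'a='a] by (simp add: Suc_diff_Suc numeral_2_eq_2 del: power_Suc)
qed

text \<open>Invariance carries the power of \<open>Var 0\<close> dividing \<open>s\<close> to the
  same power of every \<open>v\<close>, enough to cover all associates of \<open>v\<close> among the
  forms. The quotient inherits invariance because the product is invariant and nonzero.\<close>

lemma Dickson_divide:
  fixes s :: "'a::finite_field mpoly"
  assumes s: "s \<in> Dickson n" and "0 < n" and "Var 0 dvd s"
  obtains t where "t \<in> Dickson n" "s = \<Prod>(nonzero_forms n) * t"
proof -
  let ?V = "nonzero_forms n :: 'a mpoly set"
  have inv: "act g s = s" if "g \<in> GL n" for g
    using s that by (simp add: Dickson_def invariants_def)
  have "\<Prod>?V dvd s"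
  proof (rule prod_primes_dvd[OF finite_nonzero_forms prime_elem_nonzero_forms])
    fix u v :: "'a mpoly" assume "u \<in> ?V" "v \<in> ?V" "v dvd u"
    then obtain a where "a \<noteq> 0" "u = Const a * v"
      by (rule nonzero_forms_dvd)
    then have "v = u * Const (inverse a)"
      by (simp add: mult.commute mult.assoc flip: mult.assoc[of "Const _" "Const _"] Const_mult)
    then show "u dvd v" ..
  next
    fix v assume v: "v \<in> ?V"
    obtain g where g: "g \<in> GL n" "act g (Var 0) = v"
      using nonzero_forms_transitive[OF v] .
    \<comment> \<open>The associates of \<open>v\<close> are its nonzero scalar multiples, at most
      \<open>CARD('a) - 1\<close> of them.\<close>
    have "{u \<in> ?V. v dvd u} \<subseteq> (\<lambda>a. Const a * v) ` (UNIV - {0})"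
      by (auto elim: nonzero_forms_dvd[OF _ v])
    then have "card {u \<in> ?V. v dvd u} \<le> card ((\<lambda>a. Const a * v) ` (UNIV - {0}))"
      by (intro card_mono) auto
    also have "\<dots> \<le> card (UNIV - {0 :: 'a})"
      by (rule card_image_le) simp
    also have "\<dots> = CARD('a) - 1"
      by (simp add: card_Diff_singleton)
    finally have "v ^ card {u \<in> ?V. v dvd u} dvd v ^ (CARD('a) - 1)"
      by (rule le_imp_power_dvd)
    also have "\<dots> = act g (Var 0 ^ (CARD('a) - 1))"
      by (simp add: g(2) act_hom.base.hom_power)
    also have "\<dots> dvd act g s"
      by (intro act_hom.base.hom_dvd Dickson_Var_0_power_dvd[OF assms])
    finally show "v ^ card {u \<in> ?V. v dvd u} dvd s"
      using inv[OF g(1)] by simp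
  qed
  then obtain t where t: "s = \<Prod>?V * t" ..
  have "t \<in> poly_ring n"
    by (rule quotient_in_poly_ring[OF _ prod_nonzero_forms_in_poly_ring prod_nonzero_forms_nonzero])
      (use s in \<open>simp flip: t add: Dickson_def invariants_def\<close>)
  moreover have "act g t = t" if "g \<in> GL n" for g
    using inv[OF that] prod_nonzero_forms_nonzero[of n, where 'a='a]
    by (simp add: t act_hom.base.hom_mult act_prod_nonzero_forms[OF that])
  ultimately show thesis
    by (intro that[OF _ t]) (simp add: Dickson_def invariants_def)
qed

section \<open>Interpolation over the linear forms\<close>

locale parabolic_invariant =
  fixes n :: nat and f :: "'a::finite_field mpoly"
  assumes n_pos: "0 < n" and f_invariant: "f \<in> parabolic_invariants 1 (n - 1)"
begin

abbreviation V :: "'a mpoly set" where "V \<equiv> nonzero_forms n"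

definition translate :: "'a mpoly \<Rightarrow> 'a mpoly"
  where "translate v = act (SOME g. g \<in> GL n \<and> act g (Var 0) = v) f"

lemma f_in_poly_ring: "f \<in> poly_ring n"
  using f_invariant n_pos by (simp add: parabolic_invariants_def invariants_def)

lemma act_f: "g \<in> parabolic 1 (n - 1) \<Longrightarrow> act g f = f"
  using f_invariant by (simp add: parabolic_invariants_def invariants_def)

text \<open>Well defined because the stabilizer of the first variable lies in the parabolic subgroup.\<close>

lemma translate_eq:
  assumes g: "g \<in> GL n" "act g (Var 0) = v"
  shows "translate v = act g f"
proof -
  define g' where "g' = (SOME g :: 'a mat. g \<in> GL n \<and> act g (Var 0) = v)"
  have g': "g' \<in> GL n" "act g' (Var 0) = v"
    using someI_ex[of "\<lambda>g. g \<in> GL n \<and> act g (Var 0) = v"] g unfolding g'_def by blast+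
  obtain h where h: "h \<in> GL n" "\<And>f. f \<in> poly_ring n \<Longrightarrow> act h (act g' f) = f"
    "\<And>f. f \<in> poly_ring n \<Longrightarrow> act g' (act h f) = f"
    using GL_act_inverse[OF g'(1)] by blast
  have hg: "h * g \<in> GL n"
    using h(1) g(1) by (rule GL_mult)
  have act_hg: "act (h * g) x = act h (act g x)" if "x \<in> poly_ring n" for x
    using h(1) g(1) that by (intro act_mult GL_carrier) auto
  have "act (h * g) (Var 0) = Var 0"
    using n_pos g(2) g'(2) h(2)[of "Var 0"] by (simp add: act_hg)
  then have "lin_form n (\<lambda>i. (h * g) $$ (i, 0)) = lin_form n (\<lambda>i. if i = 0 then 1 else 0)"
    by (metis act_Var_lin_form[OF GL_carrier[OF hg]] Var_eq_lin_form[OF n_pos])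
  then have "\<forall>i<n. (h * g) $$ (i, 0) = (if i = 0 then 1 else 0)"
    by (simp only: lin_form_eq_iff)
  then have "h * g \<in> parabolic 1 (n - 1)"
    unfolding parabolic_1_iff using hg n_pos by simp
  then have "act h (act g f) = f"
    using act_f[of "h * g"] by (simp add: act_hg f_in_poly_ring)
  moreover have "act g f \<in> poly_ring n"
    using g(1) f_in_poly_ring by (intro act_in_poly_ring GL_carrier)
  ultimately have "act g f = act g' f"
    using h(3)[of "act g f"] by simp
  then show ?thesis
    by (simp add: translate_def g'_def)
qed

lemma translate_Var_0: "translate (Var 0) = f"
proof -
  have "1\<^sub>m n \<in> (GL n :: 'a mat set)"
    by (simp add: GL_iff_det)
  then show ?thesis
    using translate_eq[of "1\<^sub>m n" "Var 0"] n_pos f_in_poly_ring by (simp add: act_one)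
qed

lemma translate_in_poly_ring: "v \<in> V \<Longrightarrow> translate v \<in> poly_ring n"
  using nonzero_forms_transitive[of v n] translate_eq f_in_poly_ring
  by (metis GL_carrier act_in_poly_ring)

lemma translate_act:
  assumes g: "g \<in> GL n" and v: "v \<in> V"
  shows "translate (act g v) = act g (translate v)"
proof -
  obtain k where k: "k \<in> GL n" "act k (Var 0) = v"
    using nonzero_forms_transitive[OF v] .
  have "act (g * k) x = act g (act k x)" if "x \<in> poly_ring n" for x
    using g k(1) that by (intro act_mult GL_carrier) auto
  then show ?thesis
    using translate_eq[OF k] translate_eq[OF GL_mult[OF g k(1)]] k(2) n_pos f_in_poly_ring
    by simp
qed

text \<open>\<open>Const a * v\<close> is reached by applying \<open>scale_first n a\<close> before
  \<open>k\<close>; that matrix is parabolic and fixes \<open>f\<close>.\<close>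

lemma translate_scale:
  assumes a: "a \<noteq> 0" and v: "v \<in> V"
  shows "translate (Const a * v) = translate v"
proof -
  obtain k where k: "k \<in> GL n" "act k (Var 0) = v"
    using nonzero_forms_transitive[OF v] .
  have d: "scale_first n a \<in> parabolic 1 (n - 1)"
    using n_pos a by (rule scale_first_in_parabolic)
  then have d_GL: "scale_first n a \<in> GL n"
    using parabolic_subset_GL[of 1 "n - 1", where 'a='a] n_pos by auto
  have act_kd: "act (k * scale_first n a) x = act k (act (scale_first n a) x)"
    if "x \<in> poly_ring n" for x
    using k(1) d_GL that by (intro act_mult GL_carrier) auto
  have "act (k * scale_first n a) (Var 0) = Const a * v"
    using n_pos k(2) by (simp add: act_kd act_scale_first_Var_0 act_hom.base.hom_mult)
  then have "translate (Const a * v) = act k (act (scale_first n a) f)"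
    using translate_eq[OF GL_mult[OF k(1) d_GL]] f_in_poly_ring by (simp add: act_kd)
  also have "\<dots> = translate v"
    using act_f[OF d] translate_eq[OF k] by simp
  finally show ?thesis .
qed

text \<open>Both forms can be completed with the same index \<open>i\<close>. The two matrices then
  differ at most in the entry \<open>(0, 0)\<close>, which is invisible modulo
  \<open>Var 0\<close>.\<close>

lemma kill_translate_cong:
  assumes v: "v \<in> V" and w: "w \<in> V" and eq: "kill v = kill w" and "kill v \<noteq> 0"
  shows "kill (translate v) = kill (translate w)"
proof -
  obtain c i0 where c: "v = lin_form n c" "i0 < n" "c i0 \<noteq> 0"
    using v by (rule nonzero_formsE)
  obtain d j0 where d: "w = lin_form n d" "j0 < n" "d j0 \<noteq> 0"
    using w by (rule nonzero_formsE)
  have cd: "c i = d i" if "0 < i" "i < n" for i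
  proof -
    have "(c(0 := 0)) i = (d(0 := 0)) i"
      using eq that unfolding c d kill_lin_form lin_form_eq_iff by blast
    with that show ?thesis by simp
  qed
  \<comment> \<open>The coefficient at a positive index is common to \<open>v\<close> and
    \<open>w\<close>.\<close>
  obtain i where i: "0 < i" "i < n" "c i \<noteq> 0"
    using \<open>kill v \<noteq> 0\<close> by (auto simp: c kill_lin_form lin_form_eq_0_iff split: if_splits)
  have "translate v = act (completion n c i) f" "translate w = act (completion n d i) f"
    using i cd[of i] n_pos
    by (auto intro!: translate_eq completion_in_GL simp: act_completion_Var_0 c d)
  moreover have "kill (act (completion n c i) f) = kill (act (completion n d i) f)"
    unfolding act_subst_poly[OF completion_carrier]
    by (rule kill_subst_poly_cong[OF f_in_poly_ring])
      (auto simp: kill_lin_form lin_form_eq_iff cd completion_def)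
  ultimately show ?thesis by simp
qed

text \<open>
  \<open>interpolant\<close> is the Lagrange interpolation polynomial of \<open>translate\<close> on \<open>V\<close>, multiplied by
  the common denominator \<open>\<Prod>V\<close>.
\<close>

definition interpolant :: "'a mpoly poly"
  where "interpolant = (\<Sum>v\<in>V. Polynomial.smult (translate v * v) (\<Prod>u\<in>V - {v}. [:- u, 1:]))"

text \<open>The map sending \<open>u\<close> to \<open>v - u\<close> is an involution of
  \<open>V - {v}\<close>. Thus the Lagrange denominator at \<open>v\<close> is
  \<open>\<Prod>V\<close> divided by \<open>v\<close>, which explains the factor \<open>v\<close> in
  \<open>interpolant\<close>.\<close>

lemma prod_differences:
  assumes "v \<in> V"
  shows "v * (\<Prod>u\<in>V - {v}. v - u) = \<Prod>V"
proof -
  have V_diff: "v - u \<in> V - {v}" if "u \<in> V - {v}" for u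
  proof -
    obtain c where "v = lin_form n c" using assms by (rule nonzero_formsE)
    moreover have "u \<in> V" using that by simp
    then obtain d where "u = lin_form n d" by (rule nonzero_formsE)
    ultimately have "v - u = lin_form n (\<lambda>i. c i + - 1 * d i)"
      unfolding lin_form_add lin_form_scale by (simp add: Const_uminus)
    moreover have "u \<noteq> 0" using that by (auto simp: nonzero_forms_def)
    ultimately show ?thesis using that by (auto simp: nonzero_forms_def)
  qed
  have "bij_betw (\<lambda>u. v - u) (V - {v}) (V - {v})"
    by (rule bij_betw_byWitness[where f' = "\<lambda>u. v - u"]) (use V_diff in auto)
  then have "(\<Prod>u\<in>V - {v}. v - u) = \<Prod>(V - {v})"
    by (rule prod.reindex_bij_betw)
  then show ?thesis
    using prod.remove[OF finite_nonzero_forms assms, of "\<lambda>x. x"] by simp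
qed

lemma poly_interpolant:
  assumes "v \<in> V"
  shows "poly interpolant v = translate v * \<Prod>V"
proof -
  have "poly interpolant v = (\<Sum>w\<in>V. translate w * w * (\<Prod>u\<in>V - {w}. v - u))"
    by (simp add: interpolant_def poly_sum poly_prod mult.assoc)
  also have "\<dots> = (\<Sum>w\<in>V. if w = v then translate v * (v * (\<Prod>u\<in>V - {v}. v - u)) else 0)"
    using assms by (intro sum.cong) (auto simp: mult.assoc)
  also have "\<dots> = translate v * \<Prod>V"
    using assms by (simp add: prod_differences)
  finally show ?thesis .
qed

lemma degree_interpolant: "degree interpolant < card V"
proof -
  have "V \<noteq> {}"
    using Var_in_nonzero_forms[OF n_pos] by blast
  then have "card V > 0"
    by (simp add: card_gt_0_iff)
  have "degree (Polynomial.smult (translate v * v) (\<Prod>u\<in>V - {v}. [:- u, 1:])) \<le> card V - 1"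
    if "v \<in> V" for v
  proof -
    have "degree (\<Prod>u\<in>V - {v}. [:- u, 1:]) \<le> (\<Sum>u\<in>V - {v}. degree [:- u, 1:])"
      using degree_prod_sum_le[of "V - {v}" "\<lambda>u. [:- u, 1:]"]
      by (simp add: comp_def)
    also have "\<dots> = card V - 1"
      using that by (simp add: card_Diff_singleton)
    finally show ?thesis
      using degree_smult_le le_trans by blast
  qed
  then have "degree interpolant \<le> card V - 1"
    unfolding interpolant_def by (intro degree_sum_le finite_nonzero_forms)
  with \<open>card V > 0\<close> show ?thesis by linarith
qed

text \<open>Both polynomials take the same values on \<open>V\<close> and have degree below
  \<open>card V\<close>. The lemma serves for truncation and for the action of matrices
  alike.\<close>

lemma map_poly_interpolant:
  assumes hom: "comm_ring_hom \<theta>" and bij: "bij_betw \<theta> V V"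
    and translate: "\<And>v. v \<in> V \<Longrightarrow> translate (\<theta> v) = \<theta> (translate v)"
  shows "map_poly \<theta> interpolant = interpolant"
proof (rule poly_eqI_degree_roots[of V])
  interpret comm_ring_hom \<theta> by fact
  have prod: "\<theta> (\<Prod>V) = \<Prod>V"
    using prod.reindex_bij_betw[OF bij, of "\<lambda>x. x"] by (simp add: hom_prod)
  fix x assume "x \<in> V"
  then obtain v where v: "v \<in> V" "x = \<theta> v"
    using bij by (auto simp: bij_betw_def)
  then have "poly (map_poly \<theta> interpolant) x = \<theta> (poly interpolant v)"
    by simp
  also have "\<dots> = poly interpolant x"
    using v \<open>x \<in> V\<close> by (simp add: poly_interpolant hom_mult prod translate)
  finally show "poly (map_poly \<theta> interpolant) x = poly interpolant x" .
qed (use degree_interpolant degree_map_poly_le[of \<theta> interpolant] in auto)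

lemma coeff_interpolant_Dickson: "poly.coeff interpolant j \<in> Dickson n"
proof -
  have "truncate n v = v" if "v \<in> V" for v
    using that nonzero_forms_in_poly_ring by (simp flip: poly_ring_iff_truncate)
  then have "map_poly (truncate n) interpolant = interpolant"
    by (intro map_poly_interpolant truncate_hom.base.comm_ring_hom_axioms)
      (use translate_in_poly_ring in \<open>auto simp: poly_ring_iff_truncate bij_betw_def inj_on_def\<close>)
  then have "truncate n (poly.coeff interpolant j) = poly.coeff interpolant j"
    by (metis truncate_hom.base.coeff_map_poly_hom)
  moreover have "map_poly (act g) interpolant = interpolant" if "g \<in> GL n" for g
    by (intro map_poly_interpolant act_hom.base.comm_ring_hom_axioms that
        bij_betw_act_nonzero_forms translate_act)
  then have "act g (poly.coeff interpolant j) = poly.coeff interpolant j" if "g \<in> GL n" for g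
    using that by (metis act_hom.base.coeff_map_poly_hom)
  ultimately show ?thesis
    by (simp add: Dickson_def invariants_def poly_ring_iff_truncate)
qed

text \<open>Replacing X by \<open>a\<close> X leaves the values on \<open>V\<close> unchanged
  because translates ignore scalars. Comparing coefficients, the one at \<open>j\<close> is
  multiplied by \<open>a ^ j\<close>, which can be chosen different from 1.\<close>

lemma coeff_interpolant_eq_0:
  assumes "\<not> (CARD('a) - 1) dvd j"
  shows "poly.coeff interpolant j = 0"
proof -
  obtain a :: 'a where a: "a \<noteq> 0" "a ^ j \<noteq> 1"
    using card_minus_1_dvd[of j, where 'a='a] assms by blast
  have "pcompose interpolant [:0, Const a:] = interpolant"
  proof (rule poly_eqI_degree_roots[of V])
    fix v assume "v \<in> V"
    then show "poly (pcompose interpolant [:0, Const a:]) v = poly interpolant v"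
      using a by (simp add: poly_pcompose mult.commute[of v] poly_interpolant translate_scale
          scale_in_nonzero_forms)
  qed (use degree_interpolant a in \<open>auto simp: degree_pcompose\<close>)
  then have "Const a ^ j * poly.coeff interpolant j = poly.coeff interpolant j"
    by (metis coeff_pcompose_linear)
  then have "(Const (a ^ j) - 1) * poly.coeff interpolant j = 0"
    by (simp add: Const_power algebra_simps)
  then show ?thesis
    using a by simp
qed

text \<open>
  Modulo the first variable, the summands of \<open>interpolant\<close> depend only on the class of \<open>v\<close>, and
  the classes have \<open>CARD('a)\<close> elements, so the sum vanishes.
\<close>

lemma map_poly_kill_interpolant: "map_poly kill interpolant = 0"
proof -
  define T where "T v = Polynomial.smult (kill (translate v * v)) (\<Prod>u\<in>V - {v}. [:- kill u, 1:])"
    for v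
  have "map_poly kill interpolant = (\<Sum>v\<in>V. T v)"
    unfolding interpolant_def T_def
    by (simp add: kill_hom.hom_sum kill_hom.base.map_poly_hom_smult kill_hom.hom_prod
        kill_hom.base.map_poly_pCons_hom kill_hom.base.hom_uminus)
  also have "\<dots> = (\<Sum>w\<in>kill ` V. \<Sum>v\<in>{v \<in> V. kill v = w}. T v)"
    by (rule sum.group[symmetric]) simp_all
  also have "\<dots> = 0"
  proof (rule sum.neutral, clarify)
    fix v assume v: "v \<in> V"
    show "(\<Sum>u\<in>{u \<in> V. kill u = kill v}. T u) = 0"
    proof (cases "kill v = 0")
      \<comment> \<open>This class consists of the nonzero multiples of \<open>Var 0\<close> and has
        only \<open>CARD('a) - 1\<close> elements, so counting does not help. Its summands vanish
        through the factor \<open>kill u\<close>.\<close>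
      case True
      then show ?thesis
        by (intro sum.neutral) (auto simp: T_def kill_hom.base.hom_mult)
    next
      case False
      have T_eq: "T u = T v" if "u \<in> V" "kill u = kill v" for u
      proof -
        \<comment> \<open>Restoring the omitted factor gives the full product over \<open>V\<close>.
          For \<open>u\<close> and \<open>v\<close> of one class the restored factors agree and can
          be cancelled.\<close>
        have "[:- kill w, 1:] * (\<Prod>u\<in>V - {w}. [:- kill u, 1:]) = (\<Prod>u\<in>V. [:- kill u, 1:])"
          if "w \<in> V" for w
          using prod.remove[OF finite_nonzero_forms that, of "\<lambda>u. [:- kill u, 1:]"] by simp
        from this[OF v] this[OF that(1)]
        have "[:- kill v, 1:] * (\<Prod>x\<in>V - {u}. [:- kill x, 1:]) =
            [:- kill v, 1:] * (\<Prod>x\<in>V - {v}. [:- kill x, 1:])"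
          by (simp only: that(2))
        then have "(\<Prod>x\<in>V - {u}. [:- kill x, 1:]) = (\<Prod>x\<in>V - {v}. [:- kill x, 1:])"
          by (subst (asm) mult_cancel_left) auto
        moreover have "kill (translate u) = kill (translate v)"
          using that v False by (intro kill_translate_cong) auto
        ultimately show ?thesis
          using that by (simp add: T_def kill_hom.base.hom_mult)
      qed
      have fibre: "{u \<in> V. kill u = kill v} = range (\<lambda>b. v + Const b * Var 0)" (is "?l = ?r")
      proof (intro equalityI subsetI)
        fix u assume "u \<in> ?l"
        then obtain c d where c: "u = lin_form n c" and d: "v = lin_form n d"
          and eq: "kill u = kill v"
          using v by (auto elim!: nonzero_formsE)
        have "u = v + Const (c 0 - d 0) * Var 0"
          unfolding c d Var_eq_lin_form[OF n_pos] lin_form_scale[symmetric]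
            lin_form_add[symmetric] lin_form_eq_iff
          using eq by (auto simp: c d kill_lin_form lin_form_eq_iff)
        then show "u \<in> ?r" by blast
      next
        fix u assume "u \<in> ?r"
        then obtain b where u: "u = v + Const b * Var 0" by blast
        obtain d where d: "v = lin_form n d" using v by (rule nonzero_formsE)
        have "u \<in> range (lin_form n)"
          unfolding u d Var_eq_lin_form[OF n_pos] lin_form_scale[symmetric]
            lin_form_add[symmetric] by blast
        moreover have "kill u = kill v"
          by (simp add: u kill_hom.base.hom_add kill_hom.base.hom_mult kill_Var)
        ultimately show "u \<in> ?l"
          using False by (auto simp: nonzero_forms_def)
      qed
      have "inj (\<lambda>b. v + Const b * Var 0)"
        by (rule injI) simp
      then have "card {u \<in> V. kill u = kill v} = CARD('a)"
        unfolding fibre by (rule card_image)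
      then have "(\<Sum>u\<in>{u \<in> V. kill u = kill v}. T u) = of_nat CARD('a) * T v"
        using T_eq by simp
      also have "of_nat CARD('a) = [:Const (of_nat CARD('a)) :: 'a mpoly:]"
        by (simp only: Const_of_nat of_nat_poly)
      finally show ?thesis
        by (simp add: of_nat_card_finite_field)
    qed
  qed
  finally show ?thesis .
qed

lemma Var_0_dvd_coeff_interpolant: "Var 0 dvd poly.coeff interpolant j"
  using kill_hom.base.coeff_map_poly_hom[of interpolant j] map_poly_kill_interpolant
  by (simp flip: kill_eq_0_iff)

text \<open>The value of \<open>interpolant\<close> at \<open>Var 0\<close> is
  \<open>f * \<Prod>V\<close>, and all its coefficients are divisible by \<open>\<Prod>V\<close>.
  The assumption says that \<open>card V\<close> is \<open>CARD('a) - 1\<close> times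
  \<open>Suc A\<close>, so the multiples of \<open>CARD('a) - 1\<close> below \<open>card V\<close>
  are those with factor \<open>m \<le> A\<close>.\<close>

lemma Dickson_expansion:
  assumes A: "(CARD('a) - 1) * Suc A = CARD('a) ^ n - 1"
  obtains t where "\<And>m. t m \<in> Dickson n" "f = (\<Sum>m\<le>A. t m * Var 0 ^ ((CARD('a) - 1) * m))"
proof -
  let ?q = "CARD('a) - 1"
  have "?q > 0"
    using card_field_ge_2[where 'a='a] by simp
  have "\<exists>s \<in> Dickson n. poly.coeff interpolant j = \<Prod>V * s" for j
    using Dickson_divide[OF coeff_interpolant_Dickson n_pos Var_0_dvd_coeff_interpolant] by metis
  then obtain s where s: "\<And>j. s j \<in> Dickson n" "\<And>j. poly.coeff interpolant j = \<Prod>V * s j"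
    by metis
  have card_V: "card V = ?q * Suc A"
    by (simp only: card_nonzero_forms A)
  have "\<Prod>V * f = poly interpolant (Var 0)"
    by (simp add: poly_interpolant Var_in_nonzero_forms n_pos translate_Var_0 mult.commute)
  also have "\<dots> = (\<Sum>j<card V. poly.coeff interpolant j * Var 0 ^ j)"
    unfolding poly_altdef
    by (rule sum.mono_neutral_left) (use degree_interpolant in \<open>auto simp: coeff_eq_0\<close>)
  also have "\<dots> = (\<Sum>j\<in>(*) ?q ` {..A}. poly.coeff interpolant j * Var 0 ^ j)"
  proof (rule sum.mono_neutral_right)
    show "(*) ?q ` {..A} \<subseteq> {..<card V}"
      using \<open>?q > 0\<close> by (auto simp: card_V simp del: mult_Suc_right)
    show "\<forall>j\<in>{..<card V} - (*) ?q ` {..A}. poly.coeff interpolant j * Var 0 ^ j = 0"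
    proof
      fix j assume j: "j \<in> {..<card V} - (*) ?q ` {..A}"
      have "\<not> ?q dvd j"
      proof
        assume "?q dvd j"
        then obtain m where m: "j = ?q * m" ..
        with j have "m < Suc A"
          by (simp add: card_V del: mult_Suc_right)
        with j m show False by auto
      qed
      then show "poly.coeff interpolant j * Var 0 ^ j = 0"
        using coeff_interpolant_eq_0[of j] by simp
    qed
  qed simp
  also have "\<dots> = (\<Sum>m\<le>A. poly.coeff interpolant (?q * m) * Var 0 ^ (?q * m))"
    by (subst sum.reindex) (use \<open>?q > 0\<close> in \<open>auto simp: inj_on_def\<close>)
  also have "\<dots> = \<Prod>V * (\<Sum>m\<le>A. s (?q * m) * Var 0 ^ (?q * m))"
    by (simp add: s(2) sum_distrib_left mult.assoc)
  finally have "f = (\<Sum>m\<le>A. s (?q * m) * Var 0 ^ (?q * m))"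
    by simp
  with s(1) show thesis
    using that[of "\<lambda>m. s (?q * m)"] by blast
qed

end

section \<open>Linear independence and the basis theorem\<close>

lemma Dickson_independent:
  fixes c :: "nat \<Rightarrow> 'a::finite_field mpoly"
  assumes A: "(CARD('a) - 1) * Suc A = CARD('a) ^ n - 1" and "0 < n" and "I \<subseteq> {..A}"
    and c: "\<And>m. m \<in> I \<Longrightarrow> c m \<in> Dickson n"
    and sum_0: "(\<Sum>m\<in>I. c m * Var 0 ^ ((CARD('a) - 1) * m)) = 0" and "m \<in> I"
  shows "c m = 0"
proof -
  let ?q = "CARD('a) - 1" and ?V = "nonzero_forms n :: 'a mpoly set"
  have "?q > 0"
    using card_field_ge_2[where 'a='a] by simp
  have "finite I"
    using \<open>I \<subseteq> {..A}\<close> by (rule finite_subset) simp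
  define F where "F = (\<Sum>m\<in>I. Polynomial.monom (c m) (?q * m))"
  have card_V: "card ?V = ?q * Suc A"
    by (simp only: card_nonzero_forms A)
  have "F = 0"
  proof (rule poly_eqI_degree_roots[of ?V])
    fix v assume "v \<in> ?V"
    then obtain g where g: "g \<in> GL n" "act g (Var 0) = v"
      by (rule nonzero_forms_transitive)
    have "poly F v = (\<Sum>m\<in>I. act g (c m * Var 0 ^ (?q * m)))"
      using c g
      by (auto simp: F_def poly_sum poly_monom act_hom.base.hom_mult act_hom.base.hom_power
          Dickson_def invariants_def intro!: sum.cong)
    also have "\<dots> = act g 0"
      by (simp only: sum_0 flip: act_hom.base.hom_sum)
    finally show "poly F v = poly 0 v" by simp
  next
    \<comment> \<open>The bound is \<open>?q\<close> less than the number \<open>?q * Suc A\<close>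
      of roots.\<close>
    have "degree F \<le> ?q * A"
      unfolding F_def
    proof (rule degree_sum_le[OF \<open>finite I\<close>])
      fix m assume "m \<in> I"
      with \<open>I \<subseteq> {..A}\<close> have "?q * m \<le> ?q * A"
        by (intro mult_le_mono2) auto
      then show "degree (Polynomial.monom (c m) (?q * m)) \<le> ?q * A"
        using degree_monom_le le_trans by blast
    qed
    also have "\<dots> < card ?V"
      using \<open>?q > 0\<close> by (simp add: card_V)
    finally show "degree F < card ?V" .
    then show "degree 0 < card ?V" by simp
  qed
  then have "0 = poly.coeff F (?q * m)" by simp
  also have "\<dots> = (\<Sum>k\<in>I. if k = m then c k else 0)"
    using \<open>?q > 0\<close> by (simp add: F_def coeff_sum)
  also have "\<dots> = c m"
    using \<open>finite I\<close> \<open>m \<in> I\<close> by simp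
  finally show ?thesis by simp
qed

theorem free_module_basis_parabolic_invariants:
  assumes "0 < n" and A: "(CARD('a::finite_field) - 1) * Suc A = CARD('a) ^ n - 1"
  shows "free_module_basis (Dickson n) (parabolic_invariants 1 (n - 1))
    {Var 0 ^ ((CARD('a) - 1) * m) :: 'a mpoly | m. m \<le> A}"
proof -
  let ?q = "CARD('a) - 1"
  let ?M = "parabolic_invariants 1 (n - 1) :: 'a mpoly set"
  define b where "b m = (Var 0 ^ (?q * m) :: 'a mpoly)" for m
  define B where "B = b ` {..A}"
  have "?q > 0"
    using card_field_ge_2[where 'a='a] by simp
  have "inj b"
  proof (rule injI)
    fix k m assume "b k = b m"
    then have "Poly_Mapping.single (Poly_Mapping.single (0 :: nat) (?q * k)) (1 :: 'a) =
        Poly_Mapping.single (Poly_Mapping.single 0 (?q * m)) 1"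
      by (simp add: b_def Var_power)
    then have "Poly_Mapping.single (0 :: nat) (?q * k) = Poly_Mapping.single 0 (?q * m)"
      by (metis lookup_single_eq lookup_single_not_eq zero_neq_one)
    with \<open>?q > 0\<close> show "k = m"
      by (metis lookup_single_eq mult_cancel1 not_less0)
  qed
  \<comment> \<open>A parabolic matrix multiplies \<open>Var 0\<close> by a nonzero scalar, whose
    power with exponent \<open>?q\<close> is 1.\<close>
  have b_M: "b m \<in> ?M" for m
  proof -
    have "act g (b m) = b m" if "g \<in> parabolic 1 (n - 1)" for g
    proof -
      have "g \<in> GL n" and col: "\<forall>i<n. i \<noteq> 0 \<longrightarrow> g $$ (i, 0) = 0"
        using that \<open>0 < n\<close> unfolding parabolic_1_iff by auto
      have g_Var: "act g (Var 0) = Const (g $$ (0, 0)) * Var 0"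
        using \<open>0 < n\<close> col by (simp add: act_Var_lin_form[OF GL_carrier[OF \<open>g \<in> GL n\<close>]])
          (simp add: Var_eq_lin_form[of 0 n] lin_form_eq_iff flip: lin_form_scale)
      have "act g (Var 0) \<in> nonzero_forms n"
        using act_nonzero_forms_subset[OF \<open>g \<in> GL n\<close>] Var_in_nonzero_forms[OF \<open>0 < n\<close>] by blast
      then have "g $$ (0, 0) \<noteq> 0"
        by (auto simp: g_Var nonzero_forms_def)
      then have "Const (g $$ (0, 0)) ^ ?q = 1"
        using finite_field_power_minus_1[of "g $$ (0, 0)"] by (simp flip: Const_power)
      then show ?thesis
        by (simp add: b_def power_mult act_hom.base.hom_power g_Var power_mult_distrib)
    qed
    then show ?thesis
      using \<open>0 < n\<close> by (auto simp: parabolic_invariants_def invariants_def b_def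
          intro: power_in_poly_ring)
  qed
  have M_sum: "sum h I \<in> ?M" if "\<And>i. i \<in> I \<Longrightarrow> h i \<in> ?M" for h and I :: "'a mpoly set"
    using that by (auto simp: parabolic_invariants_def invariants_def act_hom.base.hom_sum
        intro!: sum_in_poly_ring sum.cong)
  have M_mult: "x * y \<in> ?M" if "x \<in> ?M" "y \<in> ?M" for x y
    using that by (auto simp: parabolic_invariants_def invariants_def act_hom.base.hom_mult
        intro: mult_in_poly_ring)
  have reindex: "(\<Sum>x\<in>S. c x * x) = (\<Sum>m | m \<le> A \<and> b m \<in> S. c (b m) * Var 0 ^ (?q * m))"
    if "S \<subseteq> B" for S and c :: "'a mpoly \<Rightarrow> 'a mpoly"
  proof -
    have "S = b ` {m. m \<le> A \<and> b m \<in> S}"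
      using that by (auto simp: B_def)
    then have "(\<Sum>x\<in>S. c x * x) = (\<Sum>x\<in>b ` {m. m \<le> A \<and> b m \<in> S}. c x * x)"
      by simp
    also have "\<dots> = (\<Sum>m | m \<le> A \<and> b m \<in> S. c (b m) * Var 0 ^ (?q * m))"
      using \<open>inj b\<close> by (subst sum.reindex) (auto simp: b_def inj_on_def inj_def)
    finally show ?thesis .
  qed
  have "free_module_basis (Dickson n) ?M B"
    unfolding free_module_basis_def
  proof (intro conjI equalityI subsetI allI impI)
    show "x \<in> ?M" if "x \<in> B" for x
      using that b_M by (auto simp: B_def)
  next
    fix f assume "f \<in> ?M"
    then interpret parabolic_invariant n f
      using \<open>0 < n\<close> by unfold_locales
    obtain t where t: "\<And>m. t m \<in> Dickson n" "f = (\<Sum>m\<le>A. t m * Var 0 ^ (?q * m))"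
      using Dickson_expansion[OF A] by blast
    \<comment> \<open>Coefficients are indexed by basis elements here, so the exponent is recovered
      by inverting the injective \<open>b\<close>.\<close>
    have "f = (\<Sum>x\<in>B. t (inv_into UNIV b x) * x)"
      unfolding B_def t(2) b_def[symmetric]
      by (subst sum.reindex) (use \<open>inj b\<close> in \<open>auto intro: inj_on_subset\<close>)
    with t(1) show "f \<in> {\<Sum>b\<in>S. c b * b | S c. finite S \<and> S \<subseteq> B \<and> (\<forall>b\<in>S. c b \<in> Dickson n)}"
      by (intro CollectI exI[of _ B] exI[of _ "\<lambda>x. t (inv_into UNIV b x)"]) (simp add: B_def)
  next
    fix f assume "f \<in> {\<Sum>b\<in>S. c b * b | S c. finite S \<and> S \<subseteq> B \<and> (\<forall>b\<in>S. c b \<in> Dickson n)}"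
    then obtain S c where S: "f = (\<Sum>x\<in>S. c x * x)" "S \<subseteq> B" "\<forall>x\<in>S. c x \<in> Dickson n"
      by blast
    show "f \<in> ?M"
      unfolding S(1)
      by (intro M_sum M_mult) (use S b_M Dickson_subset_parabolic_invariants[OF \<open>0 < n\<close>, where 'a='a]
          in \<open>auto simp: B_def\<close>)
  next
    fix S c
    assume S: "finite S \<and> S \<subseteq> B \<and> (\<forall>x\<in>S. c x \<in> Dickson n) \<and> (\<Sum>x\<in>S. c x * x) = 0"
    show "\<forall>x\<in>S. c x = 0"
    proof
      fix x assume "x \<in> S"
      with S obtain m where m: "m \<le> A" "x = b m" by (auto simp: B_def)
      have "c (b m) = 0"
        by (rule Dickson_independent[OF A \<open>0 < n\<close>, of "{m. m \<le> A \<and> b m \<in> S}" "\<lambda>m. c (b m)"])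
          (use S m \<open>x \<in> S\<close> reindex[of S c] in auto)
      with m show "c x = 0" by simp
    qed
  qed
  moreover have "B = {Var 0 ^ (?q * m) | m. m \<le> A}"
    by (auto simp: B_def b_def)
  ultimately show ?thesis by simp
qed

theorem proposition29:
  fixes n p A1 :: nat and h1 :: "'p::prime_card mod_ring mpoly"
  assumes "p = CARD('p)" and "odd p" and "n \<ge> 2"
    and "A1 = (\<Sum>i = 1..n-1. p ^ i)"
    and "h1 = Var 0"
  shows "free_module_basis (Dickson n) (parabolic_invariants 1 (n - 1))
           {h1 ^ ((p - 1) * m) | m. m \<le> A1}"
proof -
  have "prime p"
    using assms(1) prime_card by simp
  then have "p \<ge> 2" by (rule prime_ge_2_nat)
  have "0 < n" using assms(3) by simp
  have "(p - 1) * Suc A1 = p ^ n - 1"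
  proof -
    \<comment> \<open>The successor supplies the term \<open>p ^ 0\<close> of the geometric
      sum.\<close>
    have "Suc A1 = (\<Sum>i<n. p ^ i)"
      using \<open>0 < n\<close> by (simp add: assms(4) lessThan_atLeast0 sum.atLeast_Suc_lessThan
          atLeastLessThanSuc_atLeastAtMost[symmetric])
    \<comment> \<open>Writing \<open>p\<close> as a successor removes the truncated subtraction
      before the induction.\<close>
    moreover obtain r where "p = Suc r"
      using \<open>p \<ge> 2\<close> by (cases p) auto
    then have "(p - 1) * (\<Sum>i<k. p ^ i) + 1 = p ^ k" for k
      by (induction k) (auto simp: algebra_simps)
    ultimately show ?thesis
      by (metis add_diff_cancel_right')
  qed
  then show ?thesis
    using free_module_basis_parabolic_invariants[OF \<open>0 < n\<close>, where 'a="'p mod_ring" and A=A1]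
    by (simp add: assms(1,5))
qed

end
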